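(* Let $d\ge2$. Let $P=(p^{(1)},\ldots,p^{(d)})$ and $Q=(q^{(1)},\ldots,q^{(d)})$ be tuples of probability vectors such that $\bigcap_{k=1}^d\operatorname{supp}p^{(k)}\neq\emptyset$ and $\bigcap_{k=1}^d\operatorname{supp}q^{(k)}\neq\emptyset$, and assume that $P$ is power universal in $S^d$. The following are equivalent. (i) For all $\underline\alpha\in A_+\setminus\{e_1,\ldots,e_d\}$, with $C=\operatorname{supp}\underline\alpha$, one has $\Phi_{\underline\alpha,C}(P)\le\Phi_{\underline\alpha,C}(Q)$. (ii) For every $\varepsilon>0$ there exist two tuples of probability vectors $(q_\varepsilon^{(1)},\ldots,q_\varepsilon^{(d)})$ and $(r_\varepsilon^{(1)},\ldots,r_\varepsilon^{(d)})$ satisfying $\bigcap_{k=1}^d\operatorname{supp}q_\varepsilon^{(k)}\neq\emptyset$ and $\bigcap_{k=1}^d\operatorname{supp}r_\varepsilon^{(k)}\neq\emptyset$, and a stochastic map $T_\varepsilon$, such that $$\|q^{(k)}-q_\varepsilon^{(k)}\|_1\le\varepsilon\quad\text{and}\quad T_\varepsilon(r_\varepsilon^{(k)}\otimes p^{(k)})=r_\varepsilon^{(k)}\otimes q_\varepsilon^{(k)}\quad\text{for all }k\in[d].$$ Also, one may choose, for $n$ sufficiently large, $r_\varepsilon^{(k)}=\frac1{n+1}\bigoplus_{\ell=0}^n(q_\varepsilon^{(k)})^{\otimes\ell}\otimes(p^{(k)})^{\otimes(n-\ell)}$ for $k\in[d]$. (iii) For every $\varepsilon>0$ there exists a tuple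 of probability vectors $(q_\varepsilon^{(1)},\ldots,q_\varepsilon^{(d)})$ satisfying $\bigcap_{k=1}^d\operatorname{supp}q_\varepsilon^{(k)}\neq\emptyset$ such that $\|q^{(k)}-q_\varepsilon^{(k)}\|_1\le\varepsilon$ for all $k\in[d]$, and for $n$ sufficiently large a stochastic map $T_{\varepsilon,n}$ such that $$T_{\varepsilon,n}(p^{(k)})^{\otimes n}=(q_\varepsilon^{(k)})^{\otimes n}\quad\text{for all }k\in[d].$$
   Context: Notation: $[d]=\{1,\ldots,d\}$; $\mathbb N=\{1,2,\ldots\}$; $\mathbb R_+=[0,\infty)$; $\operatorname{supp}x$ is the set of indices of nonzero entries; $e_k$ is the $k$-th standard basis vector of $\mathbb R^d$; $\otimes$ is the Kronecker product of vectors, $p^{\otimes0}=(1)$; $\oplus$ is concatenation of vectors. All vectors within one tuple have the same length; vectors of different lengths are compared in $\|\cdot\|_1$ after padding with zeros. A stochastic map is a matrix with non-negative entries whose columns sum to $1$. The preordered semiring $S^d$: $\mathcal V^d_n$ is the set of $d$-tuples $P=(p^{(1)},\ldots,p^{(d)})$ of vectors in $\mathbb R_+^n$, viewed as $n\times d$ matrices with columns $p^{(k)}$, such that either $\bigcap_k\operatorname{supp}p^{(k)}\ne\emptyset$ or all $p^{(k)}$ are zero; $\mathcal V^d=\bigcup_{n\ge1}\mathcal V^d_n$. $P\boxplus Q=(p^{(k)}\oplus q^{(k)})_k$, $P\boxtimes Q=(p^{(k)}\otimes q^{(k)})_k$, and $P\succeq Q$ iff $TP=Q$ for some stochastic matrix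 $T$. $P\approx Q$ means that one is obtained from the other by permuting rows and adding/removing zero rows. $S^d=\mathcal V^d/\!\approx$ with the induced $\boxplus,\boxtimes,\succeq$, zero $[(0\cdots0)]$ and one $[(1\cdots1)]$. An element $u\in S^d$ is power universal if for all $x,y\in S^d$ with $x\preceq y$ there is $k\in\mathbb N$ with $y\preceq x\,u^k$. $A_+=\{\underline\alpha\in\mathbb R^d:\alpha_1+\cdots+\alpha_d=1,\ \alpha_k\ge0\ \forall k\}$. For $\underline\alpha\in A_+$ and $\operatorname{supp}\underline\alpha\subseteq C\subseteq[d]$, $$\Phi_{\underline\alpha,C}(P)=\sum_{i\in\bigcap_{c\in C}\operatorname{supp}p^{(c)}}\ \prod_{k\in\operatorname{supp}\underline\alpha}\big(p^{(k)}_i\big)^{\alpha_k}.$$ *)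

theory Defs
  imports "Jordan_Normal_Form.Matrix" "HOL-Combinatorics.Permutations" "HOL-Library.Cardinality"
begin

text \<open>
  The index set \<open>[d]\<close> is a finite type \<open>'d\<close> with \<open>d = CARD('d)\<close>. A \<open>d\<close>-tuple of vectors is a
  function \<open>'d \<Rightarrow> real vec\<close>; the condition that all its entries have the same length is carried
  explicitly by \<open>of_length\<close>.
\<close>

type_synonym rvec = "real vec"
type_synonym 'd vtuple = "'d \<Rightarrow> real vec"

definition of_length :: "nat \<Rightarrow> 'd vtuple \<Rightarrow> bool" where
  "of_length n P \<longleftrightarrow> (\<forall>k. P k \<in> carrier_vec n)"

definition vec_supp :: "rvec \<Rightarrow> nat set" where
  "vec_supp p = {i. i < dim_vec p \<and> p $ i \<noteq> 0}"

definition common_supp :: "'d vtuple \<Rightarrow> 'd set \<Rightarrow> nat set" where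
  "common_supp P C = (\<Inter>c\<in>C. vec_supp (P c))"

definition prob_vec :: "rvec \<Rightarrow> bool" where
  "prob_vec p \<longleftrightarrow> (\<forall>i<dim_vec p. 0 \<le> p $ i) \<and> (\<Sum>i<dim_vec p. p $ i) = 1"

definition prob_tuple :: "'d vtuple \<Rightarrow> bool" where
  "prob_tuple P \<longleftrightarrow> (\<exists>n. of_length n P) \<and> (\<forall>k. prob_vec (P k))"

definition kron :: "rvec \<Rightarrow> rvec \<Rightarrow> rvec" (infixr \<open>\<otimes>\<^sub>v\<close> 72) where
  "p \<otimes>\<^sub>v q = vec (dim_vec p * dim_vec q) (\<lambda>i. p $ (i div dim_vec q) * q $ (i mod dim_vec q))"

primrec kron_pow :: "rvec \<Rightarrow> nat \<Rightarrow> rvec" where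
  "kron_pow p 0 = vec 1 (\<lambda>_. 1)"
| "kron_pow p (Suc n) = p \<otimes>\<^sub>v kron_pow p n"

text \<open>The \<open>\<ell>\<^sub>1\<close>-distance, after padding the shorter vector with zeros.\<close>

definition entry0 :: "rvec \<Rightarrow> nat \<Rightarrow> real" where
  "entry0 p i = (if i < dim_vec p then p $ i else 0)"

definition l1_dist :: "rvec \<Rightarrow> rvec \<Rightarrow> real" where
  "l1_dist p q = (\<Sum>i<max (dim_vec p) (dim_vec q). \<bar>entry0 p i - entry0 q i\<bar>)"

definition stochastic :: "real mat \<Rightarrow> bool" where
  "stochastic T \<longleftrightarrow>
     (\<forall>i<dim_row T. \<forall>j<dim_col T. 0 \<le> T $$ (i, j)) \<and>
     (\<forall>j<dim_col T. (\<Sum>i<dim_row T. T $$ (i, j)) = 1)"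

text \<open>
  \<open>maps_to T P Q\<close> says that the matrix product \<open>T P\<close> is defined and equals \<open>Q\<close>. The carrier condition
  matters, because \<open>*\<^sub>v\<close> is total and yields junk for mismatching dimensions.
\<close>

definition maps_to :: "real mat \<Rightarrow> 'd vtuple \<Rightarrow> 'd vtuple \<Rightarrow> bool" where
  "maps_to T P Q \<longleftrightarrow> of_length (dim_col T) P \<and> (\<forall>k. T *\<^sub>v P k = Q k)"

definition majorizes :: "'d vtuple \<Rightarrow> 'd vtuple \<Rightarrow> bool" where
  "majorizes P Q \<longleftrightarrow> (\<exists>T. stochastic T \<and> maps_to T P Q)"

definition tuple_sum :: "'d vtuple \<Rightarrow> 'd vtuple \<Rightarrow> 'd vtuple" where
  "tuple_sum P Q = (\<lambda>k. P k @\<^sub>v Q k)"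

definition tuple_kron :: "'d vtuple \<Rightarrow> 'd vtuple \<Rightarrow> 'd vtuple" where
  "tuple_kron P Q = (\<lambda>k. P k \<otimes>\<^sub>v Q k)"

definition tuple_pow :: "'d vtuple \<Rightarrow> nat \<Rightarrow> 'd vtuple" where
  "tuple_pow P n = (\<lambda>k. kron_pow (P k) n)"

definition Vd_n :: "nat \<Rightarrow> 'd vtuple set" where
  "Vd_n n = {P. of_length n P \<and> (\<forall>k. \<forall>i<n. 0 \<le> P k $ i) \<and>
               (common_supp P UNIV \<noteq> {} \<or> (\<forall>k. P k = 0\<^sub>v n))}"

definition Vd :: "'d vtuple set" where
  "Vd = (\<Union>n\<in>{1..}. Vd_n n)"

text \<open>The rows of \<open>P\<close> and \<open>Q\<close> agree up to a permutation once zero rows have been added to both.\<close>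

definition row_equiv :: "'d vtuple \<Rightarrow> 'd vtuple \<Rightarrow> bool" where
  "row_equiv P Q \<longleftrightarrow>
     (\<exists>n m a b \<pi>. of_length n P \<and> of_length m Q \<and> n + a = m + b \<and> \<pi> permutes {..<n + a} \<and>
        (\<forall>k. \<forall>i<n + a. (P k @\<^sub>v 0\<^sub>v a) $ \<pi> i = (Q k @\<^sub>v 0\<^sub>v b) $ i))"

definition S_rel :: "'d vtuple \<Rightarrow> 'd vtuple \<Rightarrow> bool" where
  "S_rel P Q \<longleftrightarrow> P \<in> Vd \<and> Q \<in> Vd \<and> row_equiv P Q"


subsection \<open>Auxiliary facts for the quotient construction\<close>

text \<open>Up to \<open>row_equiv\<close>, a tuple is determined by the multiset of its nonzero rows.\<close>

definition rowm :: "nat \<Rightarrow> 'd vtuple \<Rightarrow> ('d \<Rightarrow> real) multiset" where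
  "rowm n P = image_mset (\<lambda>i k. P k $ i) (mset_set {..<n})"

definition nz :: "'d vtuple \<Rightarrow> ('d \<Rightarrow> real) multiset" where
  "nz P = filter_mset (\<lambda>r. r \<noteq> (\<lambda>_. 0)) (rowm (dim_vec (P undefined)) P)"

lemma of_length_dim: "of_length n P \<Longrightarrow> dim_vec (P k) = n"
  by (auto simp: of_length_def)

lemma nz_of_length: "of_length n P \<Longrightarrow> nz P = filter_mset (\<lambda>r. r \<noteq> (\<lambda>_. 0)) (rowm n P)"
  by (simp add: nz_def of_length_dim)

lemma rowm_Suc: "rowm (Suc n) P = add_mset (\<lambda>k. P k $ n) (rowm n P)"
  by (simp add: rowm_def lessThan_Suc)

lemma rowm_cong: "(\<And>k i. i < n \<Longrightarrow> P k $ i = Q k $ i) \<Longrightarrow> rowm n P = rowm n Q"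
  by (auto simp: rowm_def intro!: image_mset_cong)

lemma rowm_add: "rowm (n + m) P = rowm n P + image_mset (\<lambda>i k. P k $ (n + i)) (mset_set {..<m})"
proof (induction m)
  case 0
  show ?case by simp
next
  case (Suc m)
  have "rowm (n + Suc m) P = add_mset (\<lambda>k. P k $ (n + m)) (rowm (n + m) P)"
    by (simp add: rowm_Suc)
  then show ?case by (simp add: Suc.IH lessThan_Suc)
qed

lemma rowm_sum:
  assumes "of_length n P" "of_length m Q"
  shows "rowm (n + m) (tuple_sum P Q) = rowm n P + rowm m Q"
proof -
  have "rowm n (tuple_sum P Q) = rowm n P"
    using assms by (auto intro!: rowm_cong simp: tuple_sum_def of_length_dim)
  moreover have "image_mset (\<lambda>i k. tuple_sum P Q k $ (n + i)) (mset_set {..<m}) = rowm m Q"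
    using assms by (auto intro!: image_mset_cong simp: rowm_def tuple_sum_def of_length_dim)
  ultimately show ?thesis by (simp add: rowm_add)
qed

lemma of_length_sum: "of_length n P \<Longrightarrow> of_length m Q \<Longrightarrow> of_length (n + m) (tuple_sum P Q)"
  by (auto simp: of_length_def tuple_sum_def)

lemma of_length_kron: "of_length n P \<Longrightarrow> of_length m Q \<Longrightarrow> of_length (n * m) (tuple_kron P Q)"
  unfolding of_length_def tuple_kron_def kron_def by (metis carrier_vecD vec_carrier)

lemma of_length_zeros: "of_length a (\<lambda>_. 0\<^sub>v a)"
  by (auto simp: of_length_def)

lemma rowm_zeros: "rowm a (\<lambda>_. 0\<^sub>v a) = replicate_mset a (\<lambda>_. 0)"
proof -
  have "rowm a (\<lambda>_. 0\<^sub>v a :: rvec) = image_mset (\<lambda>_ _. 0) (mset_set {..<a})"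
    by (auto simp: rowm_def intro!: image_mset_cong)
  then show ?thesis by (simp add: image_mset_const_eq)
qed

lemma filter_replicate_zero: "filter_mset (\<lambda>r. r \<noteq> z) (replicate_mset a z) = {#}"
  by (induction a) auto

lemma filter_neq_eqD:
  assumes "filter_mset (\<lambda>r. r \<noteq> z) A = filter_mset (\<lambda>r. r \<noteq> z) B" "size A = size B"
  shows "A = B"
proof -
  have *: "M = filter_mset (\<lambda>r. r \<noteq> z) M + replicate_mset (count M z) z" for M :: "'a multiset"
    by (rule multiset_eqI) auto
  have "size M = size (filter_mset (\<lambda>r. r \<noteq> z) M) + count M z" for M :: "'a multiset"
    using arg_cong[OF *[of M], of size] by simp
  then have "count A z = count B z"
    by (metis assms add_left_cancel)
  then show ?thesis using *[of A] *[of B] assms(1) by simp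
qed

lemma row_equiv_iff:
  fixes P Q :: "'d vtuple"
  assumes P: "of_length n P" and Q: "of_length m Q"
  shows "row_equiv P Q \<longleftrightarrow> nz P = nz Q"
proof -
  let ?z = "\<lambda>a. (\<lambda>_. 0\<^sub>v a) :: 'd vtuple"
  have pad: "rowm (l + a) (\<lambda>k. X k @\<^sub>v 0\<^sub>v a) = rowm l X + replicate_mset a (\<lambda>_. 0)"
    if "of_length l X" for l a and X :: "'d vtuple"
    using rowm_sum[OF that of_length_zeros[of a]] by (simp add: tuple_sum_def rowm_zeros)
  show ?thesis
  proof
    assume "row_equiv P Q"
    then obtain n' m' a b \<pi> where *: "of_length n' P" "of_length m' Q" "n' + a = m' + b"
      "\<pi> permutes {..<n' + a}"
      "\<forall>k. \<forall>i<n' + a. (P k @\<^sub>v 0\<^sub>v a) $ \<pi> i = (Q k @\<^sub>v 0\<^sub>v b) $ i"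
      unfolding row_equiv_def by blast
    have "n' = n" "m' = m"
      using *(1,2) P Q of_length_dim by metis+
    with * have nm: "n + a = m + b" and \<pi>: "\<pi> permutes {..<n + a}"
      and eq: "\<And>k i. i < n + a \<Longrightarrow> (P k @\<^sub>v 0\<^sub>v a) $ \<pi> i = (Q k @\<^sub>v 0\<^sub>v b) $ i"
      by auto
    have "rowm (n + a) (\<lambda>k. P k @\<^sub>v 0\<^sub>v a) = rowm (m + b) (\<lambda>k. Q k @\<^sub>v 0\<^sub>v b)"
      unfolding rowm_def nm[symmetric]
      by (rule permutes_implies_image_mset_eq[OF \<pi>]) (auto simp: eq)
    then have "rowm n P + replicate_mset a (\<lambda>_. 0) = rowm m Q + replicate_mset b (\<lambda>_. 0)"
      by (simp add: pad[OF P] pad[OF Q])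
    then have "filter_mset (\<lambda>r. r \<noteq> (\<lambda>_. 0)) (rowm n P + replicate_mset a (\<lambda>_. 0)) =
      filter_mset (\<lambda>r. r \<noteq> (\<lambda>_. 0)) (rowm m Q + replicate_mset b (\<lambda>_. 0))" by simp
    then show "nz P = nz Q"
      by (simp add: nz_of_length[OF P] nz_of_length[OF Q] filter_replicate_zero)
  next
    assume nz: "nz P = nz Q"
    have "rowm n P + replicate_mset m (\<lambda>_. 0) = rowm m Q + replicate_mset n (\<lambda>_. 0)"
    proof (rule filter_neq_eqD)
      show "filter_mset (\<lambda>r. r \<noteq> (\<lambda>_. 0)) (rowm n P + replicate_mset m (\<lambda>_. 0)) =
        filter_mset (\<lambda>r. r \<noteq> (\<lambda>_. 0)) (rowm m Q + replicate_mset n (\<lambda>_. 0))"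
        using nz by (simp add: nz_of_length[OF P] nz_of_length[OF Q] filter_replicate_zero)
      show "size (rowm n P + replicate_mset m (\<lambda>_. 0)) = size (rowm m Q + replicate_mset n (\<lambda>_. 0))"
        by (simp add: rowm_def)
    qed
    then have "rowm (n + m) (\<lambda>k. Q k @\<^sub>v 0\<^sub>v n) = rowm (n + m) (\<lambda>k. P k @\<^sub>v 0\<^sub>v m)"
      using pad[OF P, of m] pad[OF Q, of n] by (simp add: add.commute)
    then obtain \<pi> where \<pi>: "\<pi> permutes {..<n + m}"
      "\<forall>i\<in>{..<n + m}. (\<lambda>k. (Q k @\<^sub>v 0\<^sub>v n) $ i) = (\<lambda>k. (P k @\<^sub>v 0\<^sub>v m) $ \<pi> i)"
      unfolding rowm_def by (rule image_mset_eq_implies_permutes[OF finite_lessThan])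
    have "(P k @\<^sub>v 0\<^sub>v m) $ \<pi> i = (Q k @\<^sub>v 0\<^sub>v n) $ i" if "i < n + m" for k i
      using fun_cong[OF bspec[OF \<pi>(2)], of i k] that by simp
    then have "n + m = m + n \<and> \<pi> permutes {..<n + m} \<and>
      (\<forall>k. \<forall>i<n + m. (P k @\<^sub>v 0\<^sub>v m) $ \<pi> i = (Q k @\<^sub>v 0\<^sub>v n) $ i)"
      using \<pi>(1) by simp
    then show "row_equiv P Q"
      unfolding row_equiv_def using P Q by blast
  qed
qed

lemma Vd_iff:
  "P \<in> Vd \<longleftrightarrow> (\<exists>n\<ge>1. of_length n P \<and> (\<forall>k. \<forall>i<n. 0 \<le> P k $ i) \<and>
               (common_supp P UNIV \<noteq> {} \<or> (\<forall>k. P k = 0\<^sub>v n)))"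
  by (auto simp: Vd_def Vd_n_def)

lemma Vd_length: "P \<in> Vd \<Longrightarrow> \<exists>n\<ge>1. of_length n P"
  by (auto simp: Vd_iff)

lemma common_supp_iff:
  "of_length n P \<Longrightarrow> i \<in> common_supp P UNIV \<longleftrightarrow> i < n \<and> (\<forall>k. P k $ i \<noteq> 0)"
  by (auto simp: common_supp_def vec_supp_def of_length_dim)

lemma S_rel_iff: "S_rel P Q \<longleftrightarrow> P \<in> Vd \<and> Q \<in> Vd \<and> nz P = nz Q"
proof -
  have "row_equiv P Q \<longleftrightarrow> nz P = nz Q" if "P \<in> Vd" "Q \<in> Vd"
    using Vd_length[OF that(1)] Vd_length[OF that(2)] by (elim exE conjE) (rule row_equiv_iff)
  then show ?thesis unfolding S_rel_def by auto
qed

text \<open>Stochastic maps compose, and relabelling rows is one.\<close>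

lemma stochastic_mult:
  assumes A: "stochastic A" and B: "stochastic B" and AB: "dim_col A = dim_row B"
  shows "stochastic (A * B)"
proof -
  have e: "(A * B) $$ (i, j) = (\<Sum>l<dim_row B. A $$ (i, l) * B $$ (l, j))"
    if "i < dim_row A" "j < dim_col B" for i j
    using that AB by (simp add: scalar_prod_def lessThan_atLeast0)
  have "0 \<le> (A * B) $$ (i, j)" if "i < dim_row A" "j < dim_col B" for i j
    unfolding e[OF that] using that A B AB
    by (intro sum_nonneg mult_nonneg_nonneg) (auto simp: stochastic_def)
  moreover have "(\<Sum>i<dim_row A. (A * B) $$ (i, j)) = 1" if "j < dim_col B" for j
  proof -
    have "(\<Sum>i<dim_row A. (A * B) $$ (i, j)) =
      (\<Sum>i<dim_row A. \<Sum>l<dim_row B. A $$ (i, l) * B $$ (l, j))"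
      by (intro sum.cong refl e) (use that in auto)
    also have "\<dots> = (\<Sum>l<dim_row B. (\<Sum>i<dim_row A. A $$ (i, l)) * B $$ (l, j))"
      by (subst sum.swap) (simp add: sum_distrib_right)
    also have "\<dots> = (\<Sum>l<dim_row B. B $$ (l, j))"
      using A AB by (intro sum.cong) (auto simp: stochastic_def)
    finally show ?thesis using B that by (simp add: stochastic_def)
  qed
  ultimately show ?thesis by (simp add: stochastic_def)
qed

lemma majorizes_trans:
  assumes "majorizes P Q" "majorizes Q R"
  shows "majorizes P R"
proof -
  obtain A where A: "stochastic A" "of_length (dim_col A) P" "\<And>k. A *\<^sub>v P k = Q k"
    using assms(1) unfolding majorizes_def maps_to_def by auto
  obtain B where B: "stochastic B" "of_length (dim_col B) Q" "\<And>k. B *\<^sub>v Q k = R k"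
    using assms(2) unfolding majorizes_def maps_to_def by auto
  have d: "dim_col B = dim_row A"
    using B(2) A(3) by (metis dim_mult_mat_vec of_length_dim)
  have "(B * A) *\<^sub>v P k = R k" for k
  proof -
    have "(B * A) *\<^sub>v P k = B *\<^sub>v (A *\<^sub>v P k)"
    proof (rule assoc_mult_mat_vec)
      show "B \<in> carrier_mat (dim_row B) (dim_row A)" using d by auto
      show "A \<in> carrier_mat (dim_row A) (dim_col A)" by auto
      show "P k \<in> carrier_vec (dim_col A)" using A(2) by (simp add: of_length_def)
    qed
    then show ?thesis by (simp add: A(3) B(3))
  qed
  moreover have "stochastic (B * A)" using stochastic_mult[OF B(1) A(1) d] .
  ultimately show ?thesis unfolding majorizes_def maps_to_def
    using A(2) by (intro exI[of _ "B * A"]) simp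
qed

lemma majorizes_relabel:
  assumes P: "of_length n P" and Q: "of_length m Q"
    and f: "\<And>j. j < n \<Longrightarrow> f j < m"
    and eq: "\<And>k i. i < m \<Longrightarrow> Q k $ i = (\<Sum>j<n. if f j = i then P k $ j else 0)"
  shows "majorizes P Q"
proof -
  define T :: "real mat" where "T = mat m n (\<lambda>(i, j). if f j = i then 1 else 0)"
  have "stochastic T" unfolding stochastic_def T_def using f by auto
  moreover have "T *\<^sub>v P k = Q k" for k
  proof (rule eq_vecI)
    fix i assume "i < dim_vec (Q k)"
    then have i: "i < m" using Q by (simp add: of_length_dim)
    have "(T *\<^sub>v P k) $ i = (\<Sum>j<n. (if f j = i then 1 else 0) * P k $ j)"
      using i P by (simp add: T_def scalar_prod_def of_length_dim lessThan_atLeast0)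
    also have "\<dots> = Q k $ i" unfolding eq[OF i] by (rule sum.cong) auto
    finally show "(T *\<^sub>v P k) $ i = Q k $ i" .
  qed (use Q in \<open>simp add: T_def of_length_dim\<close>)
  ultimately show ?thesis unfolding majorizes_def maps_to_def
    using P by (intro exI[of _ T]) (simp add: T_def)
qed

lemma majorizes_row_equiv:
  assumes "row_equiv P Q" "of_length m Q" "m \<ge> 1"
  shows "majorizes P Q"
proof -
  obtain n m' a b \<pi> where *: "of_length n P" "of_length m' Q" "n + a = m' + b"
    "\<pi> permutes {..<n + a}"
    "\<forall>k. \<forall>i<n + a. (P k @\<^sub>v 0\<^sub>v a) $ \<pi> i = (Q k @\<^sub>v 0\<^sub>v b) $ i"
    using assms(1) unfolding row_equiv_def by blast
  have "m' = m"
    using *(2) assms(2) of_length_dim by metis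
  with * have P: "of_length n P" and nm: "n + a = m + b" and \<pi>: "\<pi> permutes {..<n + a}"
    and eq: "\<And>k i. i < n + a \<Longrightarrow> (P k @\<^sub>v 0\<^sub>v a) $ \<pi> i = (Q k @\<^sub>v 0\<^sub>v b) $ i"
    by auto
  define g where "g = inv_into UNIV \<pi>"
  have g: "g j < n + a" if "j < n + a" for j
    using permutes_in_image[OF permutes_inv[OF \<pi>], of j] that by (simp add: g_def)
  have \<pi>g: "\<pi> (g j) = j" and g\<pi>: "g (\<pi> j) = j" for j
    using permutes_inverses[OF \<pi>] by (auto simp: g_def)
  have dP: "dim_vec (P k) = n" and dQ: "dim_vec (Q k) = m" for k
    using P assms(2) by (auto simp: of_length_dim)
  have Pj: "(P k @\<^sub>v 0\<^sub>v a) $ j = (Q k @\<^sub>v 0\<^sub>v b) $ g j" if "j < n + a" for j k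
    using eq[OF g[OF that], of k] by (simp add: \<pi>g)
  have P0: "P k $ j = 0" if "j < n" "\<not> g j < m" for j k
    using Pj[of j k] g[of j] that nm by (simp add: dP dQ)
  show ?thesis
  proof (rule majorizes_relabel[OF P assms(2), where f = "\<lambda>j. if g j < m then g j else 0"])
    fix j show "(if g j < m then g j else 0) < m" using assms(3) by auto
  next
    fix k i assume i: "i < m"
    have \<pi>i: "\<pi> i < n + a" using permutes_in_image[OF \<pi>, of i] i nm by simp
    have "(\<Sum>j<n. if (if g j < m then g j else 0) = i then P k $ j else 0)
        = (\<Sum>j<n. if g j = i then (P k @\<^sub>v 0\<^sub>v a) $ j else 0)"
      using P0 i by (intro sum.cong) (auto simp: dP)
    also have "\<dots> = (\<Sum>j<n + a. if g j = i then (P k @\<^sub>v 0\<^sub>v a) $ j else 0)"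
      by (rule sum.mono_neutral_left) (auto simp: dP)
    also have "\<dots> = (\<Sum>j<n + a. if j = \<pi> i then (P k @\<^sub>v 0\<^sub>v a) $ j else 0)"
      by (rule sum.cong) (auto simp: \<pi>g g\<pi>)
    also have "\<dots> = (P k @\<^sub>v 0\<^sub>v a) $ \<pi> i" using \<pi>i by simp
    also have "\<dots> = Q k $ i" using eq[of i k] i nm by (simp add: dQ)
    finally show "Q k $ i = (\<Sum>j<n. if (if g j < m then g j else 0) = i then P k $ j else 0)" ..
  qed
qed

lemma majorizes_S_rel:
  assumes "S_rel P Q"
  shows "majorizes P Q"
proof -
  from assms have PQ: "row_equiv P Q" "Q \<in> Vd" by (auto simp: S_rel_def)
  then obtain m where "1 \<le> m" "of_length m Q" using Vd_length by auto
  then show ?thesis using majorizes_row_equiv PQ(1) by simp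
qed

lemma S_rel_sym: "S_rel P Q \<Longrightarrow> S_rel Q P"
  by (simp add: S_rel_iff)

lemma Vd_sum:
  assumes "P \<in> Vd" "Q \<in> Vd"
  shows "tuple_sum P Q \<in> Vd"
proof -
  obtain n where n: "n \<ge> 1" "of_length n P" "\<forall>k. \<forall>i<n. 0 \<le> P k $ i"
    "common_supp P UNIV \<noteq> {} \<or> (\<forall>k. P k = 0\<^sub>v n)" using assms(1) by (auto simp: Vd_iff)
  obtain m where m: "m \<ge> 1" "of_length m Q" "\<forall>k. \<forall>i<m. 0 \<le> Q k $ i"
    "common_supp Q UNIV \<noteq> {} \<or> (\<forall>k. Q k = 0\<^sub>v m)" using assms(2) by (auto simp: Vd_iff)
  note L = of_length_sum[OF n(2) m(2)]
  have e: "tuple_sum P Q k $ i = (if i < n then P k $ i else Q k $ (i - n))" if "i < n + m" for k i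
    using that n(2) m(2) by (simp add: tuple_sum_def of_length_dim)
  have "common_supp (tuple_sum P Q) UNIV \<noteq> {} \<or> (\<forall>k. tuple_sum P Q k = 0\<^sub>v (n + m))"
  proof (cases "common_supp P UNIV = {} \<and> common_supp Q UNIV = {}")
    case True
    then have "P k = 0\<^sub>v n" "Q k = 0\<^sub>v m" for k using n(4) m(4) by auto
    then show ?thesis by (auto simp: tuple_sum_def)
  next
    case False
    then obtain i where "i \<in> common_supp P UNIV \<or> i \<in> common_supp Q UNIV" by auto
    then have "i \<in> common_supp (tuple_sum P Q) UNIV \<or> n + i \<in> common_supp (tuple_sum P Q) UNIV"
      unfolding common_supp_iff[OF n(2)] common_supp_iff[OF m(2)] common_supp_iff[OF L]
      by (auto simp: e)
    then show ?thesis by auto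
  qed
  moreover have "0 \<le> tuple_sum P Q k $ i" if "i < n + m" for k i
    using e[OF that] n(3) m(3) that by auto
  ultimately show ?thesis using L n(1) unfolding Vd_iff
    by (intro exI[of _ "n + m"]) auto
qed

lemma mult_add_less: "i < n \<Longrightarrow> j < m \<Longrightarrow> i * m + j < n * (m :: nat)"
  using mult_le_mono1[of "Suc i" n m] by simp

lemma div_less_mult: "i < n * m \<Longrightarrow> i div m < (n :: nat)"
  by (simp add: less_mult_imp_div_less)

lemma mod_less_mult: "i < n * m \<Longrightarrow> i mod m < (m :: nat)"
  by (cases m) auto

lemma Vd_kron:
  assumes "P \<in> Vd" "Q \<in> Vd"
  shows "tuple_kron P Q \<in> Vd"
proof -
  obtain n where n: "n \<ge> 1" "of_length n P" "\<forall>k. \<forall>i<n. 0 \<le> P k $ i"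
    "common_supp P UNIV \<noteq> {} \<or> (\<forall>k. P k = 0\<^sub>v n)" using assms(1) by (auto simp: Vd_iff)
  obtain m where m: "m \<ge> 1" "of_length m Q" "\<forall>k. \<forall>i<m. 0 \<le> Q k $ i"
    "common_supp Q UNIV \<noteq> {} \<or> (\<forall>k. Q k = 0\<^sub>v m)" using assms(2) by (auto simp: Vd_iff)
  note L = of_length_kron[OF n(2) m(2)]
  have e: "tuple_kron P Q k $ i = P k $ (i div m) * Q k $ (i mod m)" if "i < n * m" for k i
    using that n(2) m(2) by (simp add: tuple_kron_def kron_def of_length_dim)
  have "common_supp (tuple_kron P Q) UNIV \<noteq> {} \<or> (\<forall>k. tuple_kron P Q k = 0\<^sub>v (n * m))"
  proof (cases "common_supp P UNIV = {} \<or> common_supp Q UNIV = {}")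
    case True
    then have z: "(\<forall>k. P k = 0\<^sub>v n) \<or> (\<forall>k. Q k = 0\<^sub>v m)" using n(4) m(4) by auto
    have "tuple_kron P Q k = 0\<^sub>v (n * m)" for k
    proof (rule eq_vecI)
      fix i assume "i < dim_vec (0\<^sub>v (n * m))"
      then have i: "i < n * m" by simp
      then show "tuple_kron P Q k $ i = 0\<^sub>v (n * m) $ i"
        using z div_less_mult[OF i] mod_less_mult[OF i] by (auto simp: e)
    qed (use L in \<open>simp add: of_length_dim\<close>)
    then show ?thesis by auto
  next
    case False
    then obtain i j where "i \<in> common_supp P UNIV" "j \<in> common_supp Q UNIV" by auto
    then have "i * m + j \<in> common_supp (tuple_kron P Q) UNIV"
      unfolding common_supp_iff[OF n(2)] common_supp_iff[OF m(2)] common_supp_iff[OF L]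
      by (auto simp: e mult_add_less)
    then show ?thesis by auto
  qed
  moreover have "0 \<le> tuple_kron P Q k $ i" if "i < n * m" for k i
    using e[OF that] n(3) m(3) div_less_mult[OF that] mod_less_mult[OF that] by auto
  ultimately show ?thesis using L n(1) m(1) unfolding Vd_iff
    by (intro exI[of _ "n * m"]) auto
qed

lemma nz_sum: "P \<in> Vd \<Longrightarrow> Q \<in> Vd \<Longrightarrow> nz (tuple_sum P Q) = nz P + nz Q"
  by (auto dest!: Vd_length simp: nz_of_length nz_of_length[OF of_length_sum] rowm_sum)

definition rmult :: "('d \<Rightarrow> real) multiset \<Rightarrow> ('d \<Rightarrow> real) multiset \<Rightarrow> ('d \<Rightarrow> real) multiset" where
  "rmult A B = (\<Sum>r\<in>#A. image_mset (\<lambda>s k. r k * s k) B)"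

lemma rmult_simps [simp]:
  "rmult {#} B = {#}" "rmult A {#} = {#}"
  "rmult (add_mset r A) B = image_mset (\<lambda>s k. r k * s k) B + rmult A B"
  "rmult (A + A') B = rmult A B + rmult A' B"
  by (simp_all add: rmult_def)

lemma rmult_add_mset_right:
  "rmult A (add_mset s B) = image_mset (\<lambda>r k. r k * s k) A + rmult A B"
  by (induction A) auto

lemma rmult_commute: "rmult A B = rmult B A"
  by (induction A) (auto simp: rmult_add_mset_right mult.commute)

lemma rmult_add_right: "rmult A (B + B') = rmult A B + rmult A B'"
  by (simp add: rmult_commute[of A])

lemma rmult_image: "rmult (image_mset (\<lambda>s k. r k * s k) B) C = image_mset (\<lambda>s k. r k * s k) (rmult B C)"
  by (induction B) (auto simp: multiset.map_comp o_def mult.assoc)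

lemma rmult_assoc: "rmult (rmult A B) C = rmult A (rmult B C)"
  by (induction A) (auto simp: rmult_image)

lemma rmult_filter:
  "filter_mset (\<lambda>r. r \<noteq> (\<lambda>_. 0)) (rmult A B) =
   filter_mset (\<lambda>r. r \<noteq> (\<lambda>_. 0)) (rmult (filter_mset (\<lambda>r. r \<noteq> (\<lambda>_. 0)) A) (filter_mset (\<lambda>r. r \<noteq> (\<lambda>_. 0)) B))"
proof -
  have "filter_mset (\<lambda>r. r \<noteq> (\<lambda>_. 0)) (rmult A B) =
    filter_mset (\<lambda>r. r \<noteq> (\<lambda>_. 0)) (rmult (filter_mset (\<lambda>r. r \<noteq> (\<lambda>_. 0)) A) B)" for A B :: "('d \<Rightarrow> real) multiset"
    by (induction A) (auto simp: filter_mset_eq_mempty_iff)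
  then show ?thesis by (metis rmult_commute)
qed

lemma rowm_kron:
  assumes "of_length n P" "of_length m Q"
  shows "rowm (n * m) (tuple_kron P Q) = rmult (rowm n P) (rowm m Q)"
proof -
  have "rowm (n' * m) (tuple_kron P Q) = rmult (rowm n' P) (rowm m Q)" if "n' \<le> n" for n'
    using that
  proof (induction n')
    case (Suc n')
    have "image_mset (\<lambda>i k. tuple_kron P Q k $ (n' * m + i)) (mset_set {..<m}) =
      image_mset (\<lambda>i k. P k $ n' * Q k $ i) (mset_set {..<m})"
      using Suc.prems assms mult_add_less[of n' n _ m]
      by (intro image_mset_cong) (auto simp: tuple_kron_def kron_def of_length_dim)
    then have "rowm (Suc n' * m) (tuple_kron P Q) = rowm (n' * m) (tuple_kron P Q) +
      image_mset (\<lambda>i k. P k $ n' * Q k $ i) (mset_set {..<m})"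
      by (simp add: add.commute[of m] rowm_add)
    then show ?case using Suc by (simp add: rowm_Suc) (simp add: rowm_def multiset.map_comp o_def)
  qed (simp add: rowm_def)
  then show ?thesis by simp
qed

lemma nz_kron:
  assumes "P \<in> Vd" "Q \<in> Vd"
  shows "nz (tuple_kron P Q) = filter_mset (\<lambda>r. r \<noteq> (\<lambda>_. 0)) (rmult (nz P) (nz Q))"
  using assms by (auto dest!: Vd_length simp: nz_of_length nz_of_length[OF of_length_kron] rowm_kron rmult_filter[symmetric])

lemma filter_rmult_filter:
  "filter_mset (\<lambda>r. r \<noteq> (\<lambda>_. 0)) (rmult (filter_mset (\<lambda>r. r \<noteq> (\<lambda>_. 0)) A) B) =
   filter_mset (\<lambda>r. r \<noteq> (\<lambda>_. 0)) (rmult A B)"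
  "filter_mset (\<lambda>r. r \<noteq> (\<lambda>_. 0)) (rmult A (filter_mset (\<lambda>r. r \<noteq> (\<lambda>_. 0)) B)) =
   filter_mset (\<lambda>r. r \<noteq> (\<lambda>_. 0)) (rmult A B)"
  using rmult_filter[of A B] rmult_filter[of "filter_mset (\<lambda>r. r \<noteq> (\<lambda>_. 0)) A" B]
    rmult_filter[of A "filter_mset (\<lambda>r. r \<noteq> (\<lambda>_. 0)) B"] by (simp_all add: filter_filter_mset)

lemma nz_idem: "filter_mset (\<lambda>r. r \<noteq> (\<lambda>_. 0)) (nz P) = nz P"
  by (simp add: nz_def filter_filter_mset)

definition zero_tuple :: "'d vtuple" where
  "zero_tuple = (\<lambda>_. vec 1 (\<lambda>_. 0))"

definition one_tuple :: "'d vtuple" where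
  "one_tuple = (\<lambda>_. vec 1 (\<lambda>_. 1))"

lemma zero_tuple_Vd: "zero_tuple \<in> Vd"
  unfolding Vd_iff by (intro exI[of _ 1]) (auto simp: zero_tuple_def of_length_def)

lemma one_tuple_Vd: "one_tuple \<in> Vd"
  unfolding Vd_iff
  by (intro exI[of _ 1]) (auto simp: one_tuple_def of_length_def common_supp_def vec_supp_def)

lemma nz_zero: "nz zero_tuple = {#}"
  by (simp add: nz_def zero_tuple_def rowm_def lessThan_Suc)

lemma nz_one: "nz one_tuple = {#\<lambda>_. 1#}"
  by (simp add: nz_def one_tuple_def rowm_def lessThan_Suc fun_eq_iff)

lemma stochastic_one: "stochastic (1\<^sub>m n)"
  by (auto simp: stochastic_def)


subsection \<open>The preordered semiring \<open>S\<^sup>d\<close>\<close>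

quotient_type 'd S = "'d::finite vtuple" / partial: S_rel
  by (rule part_equivpI) (use zero_tuple_Vd in \<open>auto simp: S_rel_iff symp_def transp_def\<close>)

text \<open>The class \<open>[P]\<close> of a tuple \<open>P \<in> Vd\<close> is \<open>abs_S P\<close>.\<close>

instantiation S :: (finite) comm_semiring_1
begin

lift_definition zero_S :: "'a S" is zero_tuple
  by (simp add: S_rel_iff zero_tuple_Vd)

lift_definition one_S :: "'a S" is one_tuple
  by (simp add: S_rel_iff one_tuple_Vd)

lift_definition plus_S :: "'a S \<Rightarrow> 'a S \<Rightarrow> 'a S" is tuple_sum
  by (simp add: S_rel_iff Vd_sum nz_sum)

lift_definition times_S :: "'a S \<Rightarrow> 'a S \<Rightarrow> 'a S" is tuple_kron
  by (simp add: S_rel_iff Vd_kron nz_kron)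

instance
proof
  fix a b c :: "'a S"
  show "a + b + c = a + (b + c)"
    by transfer (simp add: S_rel_iff Vd_sum nz_sum)
  show "a + b = b + a"
    by transfer (simp add: S_rel_iff Vd_sum nz_sum)
  show "0 + a = a"
    by transfer (simp add: S_rel_iff Vd_sum nz_sum nz_zero zero_tuple_Vd)
  show "a * b * c = a * (b * c)"
    by transfer (simp add: S_rel_iff Vd_kron nz_kron filter_rmult_filter rmult_assoc)
  show "a * b = b * a"
    by transfer (simp add: S_rel_iff Vd_kron nz_kron rmult_commute)
  show "1 * a = a"
    by transfer (simp add: S_rel_iff Vd_kron nz_kron nz_one one_tuple_Vd nz_idem)
  show "0 * a = 0"
    by transfer (simp add: S_rel_iff Vd_kron nz_kron nz_zero zero_tuple_Vd)
  show "a * 0 = 0"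
    by transfer (simp add: S_rel_iff Vd_kron nz_kron nz_zero zero_tuple_Vd)
  show "(a + b) * c = a * c + b * c"
    by transfer (simp add: S_rel_iff Vd_kron nz_kron Vd_sum nz_sum)
  show "(0 :: 'a S) \<noteq> 1"
    by transfer (simp add: S_rel_iff nz_zero nz_one)
qed

end

instantiation S :: (finite) preorder
begin

lift_definition less_eq_S :: "'a S \<Rightarrow> 'a S \<Rightarrow> bool" is "\<lambda>Q P. majorizes P Q"
  by (meson majorizes_S_rel S_rel_sym majorizes_trans)

definition less_S :: "'a S \<Rightarrow> 'a S \<Rightarrow> bool" where
  "less_S x y \<longleftrightarrow> x \<le> y \<and> \<not> y \<le> x"

instance
proof
  fix x y z :: "'a S"
  show "x < y \<longleftrightarrow> x \<le> y \<and> \<not> y \<le> x" by (simp add: less_S_def)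
  show "x \<le> x" by transfer (rule majorizes_S_rel)
  show "x \<le> y \<Longrightarrow> y \<le> z \<Longrightarrow> x \<le> z" by transfer (rule majorizes_trans)
qed

end

definition power_universal :: "'d::finite S \<Rightarrow> bool" where
  "power_universal u \<longleftrightarrow> (\<forall>x y. x \<le> y \<longrightarrow> (\<exists>k::nat. k \<ge> 1 \<and> y \<le> x * u ^ k))"


subsection \<open>The functions \<open>\<Phi>\<close> and the explicit catalyst\<close>

definition param_supp :: "('d \<Rightarrow> real) \<Rightarrow> 'd set" where
  "param_supp \<alpha> = {k. \<alpha> k \<noteq> 0}"

definition unit_param :: "'d \<Rightarrow> 'd \<Rightarrow> real" where
  "unit_param k = (\<lambda>j. if j = k then 1 else 0)"

definition A_plus :: "('d::finite \<Rightarrow> real) set" where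
  "A_plus = {\<alpha>. (\<Sum>k\<in>UNIV. \<alpha> k) = 1 \<and> (\<forall>k. 0 \<le> \<alpha> k)}"

text \<open>Intended for \<open>\<alpha> \<in> A_plus\<close> and \<open>param_supp \<alpha> \<subseteq> C\<close>; then all bases of \<open>powr\<close> are positive.\<close>

definition Phi :: "('d::finite \<Rightarrow> real) \<Rightarrow> 'd set \<Rightarrow> 'd vtuple \<Rightarrow> real" where
  "Phi \<alpha> C P = (\<Sum>i\<in>common_supp P C. \<Prod>k\<in>param_supp \<alpha>. (P k $ i) powr \<alpha> k)"

definition vec_concat :: "rvec list \<Rightarrow> rvec" where
  "vec_concat vs = foldr (@\<^sub>v) vs (0\<^sub>v 0)"

text \<open>The explicit catalyst \<open>\<frac>1{n+1} \<Oplus>\<^sub>\<ell> q\<^sup>\<otimes>\<^sup>\<ell> \<otimes> p\<^sup>\<otimes>\<^sup>(\<^sup>n\<^sup>-\<^sup>\<ell>\<^sup>)\<close>, where \<open>\<ell>\<close> runs from \<open>0\<close> to \<open>n\<close>.\<close>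

definition catalyst :: "'d vtuple \<Rightarrow> 'd vtuple \<Rightarrow> nat \<Rightarrow> 'd vtuple" where
  "catalyst P Q n = (\<lambda>k. (1 / real (n + 1)) \<cdot>\<^sub>v
     vec_concat (map (\<lambda>l. kron_pow (Q k) l \<otimes>\<^sub>v kron_pow (P k) (n - l)) [0..<n + 1]))"

end

theory Submission
  imports Defs "HOL-Analysis.Function_Topology"
begin

text \<open>
  Since \<open>P\<close> is power universal, the support of \<open>p\<^sup>(\<^sup>k\<^sup>)\<close> is not contained in that of \<open>p\<^sup>(\<^sup>l\<^sup>)\<close> for \<open>k \<noteq> l\<close>. Call
  a row of a power of \<open>P\<close> mixed if at least two of its entries are nonzero. To map \<open>P\<^sup>\<otimes>\<^sup>n\<close> onto \<open>R\<^sup>\<otimes>\<^sup>n\<close>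
  it suffices to distribute the mixed rows over the rows of \<open>R\<^sup>\<otimes>\<^sup>n\<close> without exceeding any entry:
  every other row charges one column only, so these rows fill the remaining gaps column by column.

  Mixed rows are grouped by their support \<open>C\<close> and, up to a small mesh, by the exponents
  \<open>v\<^sub>k = - ln (p\<^sup>(\<^sup>k\<^sup>) row) / n\<close>; the number of groups does not depend on \<open>n\<close>. Let \<open>\<alpha>\<close> minimize
  \<open>ln \<Phi>\<^sub>\<alpha>(R) + \<alpha> \<bullet> v\<close> over the simplex of parameters supported in \<open>C\<close>. The group has mass at most
  \<open>(\<Phi>\<^sub>\<alpha>\<^sub>,\<^sub>C(P) exp(\<alpha> \<bullet> v - v\<^sub>k))\<^sup>n\<close> in column \<open>k\<close>, while the first order condition for \<open>\<alpha>\<close> says that the power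
  of the distribution proportional to \<open>\<Prod>\<^sub>k (r\<^sup>(\<^sup>k\<^sup>)) powr \<alpha>\<^sub>k\<close> is typically bounded by
  \<open>(exp(v\<^sub>k - \<alpha> \<bullet> v) / \<Phi>\<^sub>\<alpha>(R))\<^sup>n\<close> times \<open>r\<^sup>(\<^sup>k\<^sup>)\<^sup>\<otimes>\<^sup>n\<close>. So the group fits as soon as \<open>\<Phi>\<^sub>\<alpha>\<^sub>,\<^sub>C(P) \<le> \<rho> \<Phi>\<^sub>\<alpha>(R)\<close> with
  \<open>\<rho> < 1\<close>. Mixing \<open>Q\<close> with a little of the uniform distribution gives such an \<open>R\<close>, with the same \<open>\<rho>\<close>
  for all \<open>\<alpha>\<close> and \<open>C\<close>. Conversely, superadditivity of weighted geometric means makes \<open>\<Phi>\<^sub>\<alpha>\<close> monotone under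
  stochastic maps; it is also multiplicative and, for \<open>\<alpha> \<in> A_plus\<close>, continuous in the \<open>\<ell>\<^sub>1\<close>-distance.
\<close>

subsection \<open>Weighted geometric means\<close>

text \<open>Normalized by the arithmetic mean \<open>A\<close>, the claim is the weighted sum of the
  bounds \<open>ln t <= t - 1\<close> at \<open>t = x k / A\<close>. If some \<open>x k\<close>
  vanishes, so does the product.\<close>

lemma weighted_am_gm:
  fixes w x :: "'a \<Rightarrow> real"
  assumes S: "finite S" and w: "\<And>k. k \<in> S \<Longrightarrow> 0 < w k" "sum w S = 1"
    and x: "\<And>k. k \<in> S \<Longrightarrow> 0 \<le> x k"
  shows "(\<Prod>k\<in>S. x k powr w k) \<le> (\<Sum>k\<in>S. w k * x k)"
proof (cases "\<exists>k\<in>S. x k = 0")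
  case True
  then have "(\<Prod>k\<in>S. x k powr w k) = 0"
    using S by (auto simp: prod_zero_iff)
  moreover have "0 \<le> (\<Sum>k\<in>S. w k * x k)"
    using w x by (intro sum_nonneg mult_nonneg_nonneg) (auto simp: less_imp_le)
  ultimately show ?thesis by simp
next
  case False
  then have pos: "0 < x k" if "k \<in> S" for k using x[OF that] that by force
  define A where "A = (\<Sum>k\<in>S. w k * x k)"
  have "S \<noteq> {}" using w by auto
  then have A: "0 < A" unfolding A_def using S w pos by (intro sum_pos mult_pos_pos) auto
  have "(\<Sum>k\<in>S. w k * (ln (x k) - ln A)) \<le> (\<Sum>k\<in>S. w k * (x k / A - 1))"
  proof (rule sum_mono)
    fix k assume k: "k \<in> S"
    have "ln (x k) - ln A \<le> x k / A - 1"
      using ln_le_minus_one[of "x k / A"] pos[OF k] A by (simp add: ln_div)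
    then show "w k * (ln (x k) - ln A) \<le> w k * (x k / A - 1)"
      using w(1)[OF k] by (simp add: mult_left_mono)
  qed
  also have "\<dots> = (\<Sum>k\<in>S. w k * x k) / A - sum w S"
    by (simp add: right_diff_distrib sum_subtractf sum_divide_distrib)
  also have "\<dots> = 0" using A w by (simp add: A_def)
  finally have "(\<Sum>k\<in>S. w k * ln (x k)) \<le> ln A"
    by (simp add: right_diff_distrib sum_subtractf w(2) flip: sum_distrib_right)
  then have "exp (\<Sum>k\<in>S. w k * ln (x k)) \<le> A"
    using A by (metis exp_le_cancel_iff exp_ln)
  moreover have "exp (\<Sum>k\<in>S. w k * ln (x k)) = (\<Prod>k\<in>S. x k powr w k)"
    unfolding exp_sum[OF S] using pos by (intro prod.cong) (simp_all add: powr_def less_imp_neq[symmetric])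
  ultimately show ?thesis by (simp add: A_def)
qed

text \<open>After division of each \<open>a k j\<close> by the weighted total \<open>s k\<close>,
  AM-GM for every \<open>j\<close>, summed with the weights \<open>t j\<close>, gives the bound 1.
  The inequality yields both the monotonicity of \<open>Phi\<close> under stochastic maps and the
  effect of mixing with the uniform distribution.\<close>

lemma weighted_geometric_mean_superadditive:
  fixes w :: "'a \<Rightarrow> real" and t :: "'b \<Rightarrow> real"
  assumes S: "finite S" and w: "\<And>k. k \<in> S \<Longrightarrow> 0 < w k" "sum w S = 1"
    and J: "finite J" "\<And>j. j \<in> J \<Longrightarrow> 0 \<le> t j"
    and a: "\<And>k j. k \<in> S \<Longrightarrow> j \<in> J \<Longrightarrow> 0 \<le> a k j"
  shows "(\<Sum>j\<in>J. t j * (\<Prod>k\<in>S. a k j powr w k)) \<le> (\<Prod>k\<in>S. (\<Sum>j\<in>J. t j * a k j) powr w k)"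
proof -
  define s where "s k = (\<Sum>j\<in>J. t j * a k j)" for k
  have s0: "0 \<le> s k" if "k \<in> S" for k
    unfolding s_def using J a that by (intro sum_nonneg mult_nonneg_nonneg) auto
  show ?thesis
  proof (cases "\<exists>k\<in>S. s k = 0")
    case True
    then obtain k where k: "k \<in> S" "s k = 0" by auto
    have "t j * (\<Prod>k\<in>S. a k j powr w k) = 0" if j: "j \<in> J" for j
    proof -
      have "t j * a k j = 0"
        using k J a j unfolding s_def
        by (subst (asm) sum_nonneg_eq_0_iff) auto
      then show ?thesis using k S by (auto simp: prod_zero_iff)
    qed
    then have "(\<Sum>j\<in>J. t j * (\<Prod>k\<in>S. a k j powr w k)) = 0" by (intro sum.neutral) blast
    then show ?thesis by (simp add: prod_nonneg)
  next
    case False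
    then have s: "0 < s k" if "k \<in> S" for k using s0[OF that] that by force
    define R where "R = (\<Prod>k\<in>S. s k powr w k)"
    have "(\<Sum>j\<in>J. t j * (\<Prod>k\<in>S. a k j powr w k)) = (\<Sum>j\<in>J. t j * (R * (\<Prod>k\<in>S. (a k j / s k) powr w k)))"
    proof (intro sum.cong refl)
      fix j assume "j \<in> J"
      have "R * (\<Prod>k\<in>S. (a k j / s k) powr w k) = (\<Prod>k\<in>S. s k powr w k * (a k j / s k) powr w k)"
        by (simp add: R_def prod.distrib)
      also have "\<dots> = (\<Prod>k\<in>S. a k j powr w k)"
      proof (rule prod.cong[OF refl])
        fix k assume k: "k \<in> S"
        have "s k powr w k * (a k j / s k) powr w k = (s k * (a k j / s k)) powr w k"
          using k \<open>j \<in> J\<close> a s[OF k] by (subst powr_mult) (auto simp: less_imp_le)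
        then show "s k powr w k * (a k j / s k) powr w k = a k j powr w k" using s[OF k] by simp
      qed
      finally show "t j * (\<Prod>k\<in>S. a k j powr w k) = t j * (R * (\<Prod>k\<in>S. (a k j / s k) powr w k))" by simp
    qed
    also have "\<dots> \<le> (\<Sum>j\<in>J. t j * (R * (\<Sum>k\<in>S. w k * (a k j / s k))))"
      using J a s w S
      by (intro sum_mono mult_left_mono weighted_am_gm) (auto simp: R_def less_imp_le intro!: prod_nonneg)
    also have "\<dots> = R * (\<Sum>k\<in>S. w k * (s k / s k))"
      unfolding s_def sum_divide_distrib sum_distrib_left
      by (subst sum.swap) (simp add: mult.left_commute mult_ac)
    also have "(\<Sum>k\<in>S. w k * (s k / s k)) = 1"
      using s w(2) by (metis (mono_tags, lifting) div_self mult.right_neutral order_less_irrefl sum.cong)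
    finally show ?thesis by (simp add: R_def s_def)
  qed
qed

subsection \<open>Sums of entries and Kronecker products\<close>

definition vec_total :: "rvec \<Rightarrow> real" where
  "vec_total p = (\<Sum>i<dim_vec p. p $ i)"

lemma block_div_mod [simp]:
  fixes i j m :: nat
  assumes "j < m"
  shows "(i * m + j) div m = i" "(i * m + j) mod m = j"
  using assms by auto

lemma sum_lessThan_add:
  fixes f :: "nat \<Rightarrow> 'a::comm_monoid_add"
  shows "(\<Sum>i<n + m. f i) = (\<Sum>i<n. f i) + (\<Sum>j<m. f (n + j))"
  by (induction m) (simp_all add: add.assoc)

lemma sum_lessThan_mult:
  fixes f :: "nat \<Rightarrow> 'a::comm_monoid_add"
  shows "(\<Sum>i<n * m. f i) = (\<Sum>i<n. \<Sum>j<m. f (i * m + j))"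
proof (induction n)
  case (Suc n)
  have "(\<Sum>i<Suc n * m. f i) = (\<Sum>i<n * m + m. f i)" by (simp add: add.commute)
  also have "\<dots> = (\<Sum>i<n * m. f i) + (\<Sum>j<m. f (n * m + j))"
    by (rule sum_lessThan_add)
  finally show ?case using Suc by simp
qed simp

lemma dim_kron [simp]: "dim_vec (p \<otimes>\<^sub>v q) = dim_vec p * dim_vec q"
  by (simp add: kron_def)

lemma kron_index: "i < dim_vec p * dim_vec q \<Longrightarrow>
    (p \<otimes>\<^sub>v q) $ i = p $ (i div dim_vec q) * q $ (i mod dim_vec q)"
  by (simp add: kron_def)

lemma vec_total_kron: "vec_total (p \<otimes>\<^sub>v q) = vec_total p * vec_total q"
proof -
  have "vec_total (p \<otimes>\<^sub>v q) = (\<Sum>i<dim_vec p. \<Sum>j<dim_vec q. (p \<otimes>\<^sub>v q) $ (i * dim_vec q + j))"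
    by (simp add: vec_total_def sum_lessThan_mult)
  also have "\<dots> = (\<Sum>i<dim_vec p. \<Sum>j<dim_vec q. p $ i * q $ j)"
    by (intro sum.cong refl) (simp add: kron_index mult_add_less)
  also have "\<dots> = vec_total p * vec_total q"
    by (simp add: vec_total_def sum_product)
  finally show ?thesis .
qed

lemma dim_kron_pow [simp]: "dim_vec (kron_pow p n) = dim_vec p ^ n"
  by (induction n) auto

lemma vec_total_kron_pow: "vec_total (kron_pow p n) = vec_total p ^ n"
  by (induction n) (simp_all add: vec_total_kron, simp add: vec_total_def)

text \<open>The digits of \<open>j\<close> in base \<open>m\<close> do not depend on
  \<open>p\<close>, hence one \<open>d\<close> describes the same row in all columns of a power of a
  tuple at once.\<close>

lemma kron_pow_digits:
  assumes "j < m ^ n"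
  shows "\<exists>d. (\<forall>t<n. d t < m) \<and>
    (\<forall>p. dim_vec p = m \<longrightarrow> kron_pow p n $ j = (\<Prod>t<n. p $ d t))"
  using assms
proof (induction n arbitrary: j)
  case 0
  then show ?case by simp
next
  case (Suc n)
  have j: "j div m ^ n < m" "j mod m ^ n < m ^ n"
    using Suc.prems div_less_mult[of j m "m ^ n"] mod_less_mult[of j m "m ^ n"] by auto
  obtain d where d: "\<forall>t<n. d t < m"
    "\<And>p. dim_vec p = m \<Longrightarrow> kron_pow p n $ (j mod m ^ n) = (\<Prod>t<n. p $ d t)"
    using Suc.IH[OF j(2)] by blast
  have "kron_pow p (Suc n) $ j = (\<Prod>t<Suc n. p $ (d(n := j div m ^ n)) t)" if "dim_vec p = m" for p
    using Suc.prems that d(2)[OF that] by (simp add: kron_index mult.commute)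
  moreover have "(d(n := j div m ^ n)) t < m" if "t < Suc n" for t
    using d(1) j(1) that by (auto simp: less_Suc_eq)
  ultimately show ?case by blast
qed

lemma kron_pow_nonneg:
  assumes p: "\<And>i. i < dim_vec p \<Longrightarrow> 0 \<le> p $ i" and j: "j < dim_vec p ^ n"
  shows "0 \<le> kron_pow p n $ j"
proof -
  obtain d where d: "\<forall>t<n. d t < dim_vec p" "kron_pow p n $ j = (\<Prod>t<n. p $ d t)"
    using kron_pow_digits[OF j] by blast
  then show ?thesis using p by (auto intro!: prod_nonneg)
qed

subsection \<open>The functionals \<open>\<Phi>\<close>\<close>

lemma A_plus_supp:
  assumes "\<alpha> \<in> A_plus"
  shows "\<And>k. k \<in> param_supp \<alpha> \<Longrightarrow> 0 < \<alpha> k" "sum \<alpha> (param_supp \<alpha>) = 1" "param_supp \<alpha> \<noteq> {}"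
proof -
  show pos: "0 < \<alpha> k" if "k \<in> param_supp \<alpha>" for k
    using assms that unfolding A_plus_def param_supp_def by (auto simp: less_le)
  have "sum \<alpha> (param_supp \<alpha>) = sum \<alpha> UNIV"
    by (rule sum.mono_neutral_left) (auto simp: param_supp_def)
  then show "sum \<alpha> (param_supp \<alpha>) = 1" using assms by (simp add: A_plus_def)
  then show "param_supp \<alpha> \<noteq> {}" by auto
qed

lemma common_supp_subset: "of_length n P \<Longrightarrow> C \<noteq> {} \<Longrightarrow> common_supp P C \<subseteq> {..<n}"
  by (auto simp: common_supp_def vec_supp_def of_length_dim)

text \<open>Since \<open>0 powr a = 0\<close>, rows outside the common support add nothing, and the
  sum may run over all rows.\<close>

lemma Phi_eq_sum:
  assumes P: "of_length n P" and \<alpha>: "\<alpha> \<in> A_plus"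
  shows "Phi \<alpha> (param_supp \<alpha>) P = (\<Sum>i<n. \<Prod>k\<in>param_supp \<alpha>. (P k $ i) powr \<alpha> k)"
proof -
  have "common_supp P (param_supp \<alpha>) = {i. i < n \<and> (\<forall>k\<in>param_supp \<alpha>. P k $ i \<noteq> 0)}"
    using A_plus_supp(3)[OF \<alpha>] P by (auto simp: common_supp_def vec_supp_def of_length_dim)
  then show ?thesis unfolding Phi_def
    by (intro sum.mono_neutral_left) auto
qed

lemma Phi_kron:
  assumes P: "of_length n P" and Q: "of_length m Q" and \<alpha>: "\<alpha> \<in> A_plus"
  shows "Phi \<alpha> (param_supp \<alpha>) (tuple_kron P Q) = Phi \<alpha> (param_supp \<alpha>) P * Phi \<alpha> (param_supp \<alpha>) Q"
proof -
  have "Phi \<alpha> (param_supp \<alpha>) (tuple_kron P Q) =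
      (\<Sum>i<n. \<Sum>j<m. \<Prod>k\<in>param_supp \<alpha>. (tuple_kron P Q k $ (i * m + j)) powr \<alpha> k)"
    by (simp add: Phi_eq_sum[OF of_length_kron[OF P Q] \<alpha>] sum_lessThan_mult)
  also have "\<dots> = (\<Sum>i<n. \<Sum>j<m. (\<Prod>k\<in>param_supp \<alpha>. (P k $ i) powr \<alpha> k) * (\<Prod>k\<in>param_supp \<alpha>. (Q k $ j) powr \<alpha> k))"
    using P Q by (intro sum.cong refl)
      (simp add: tuple_kron_def kron_index of_length_dim mult_add_less powr_mult prod.distrib)
  also have "\<dots> = Phi \<alpha> (param_supp \<alpha>) P * Phi \<alpha> (param_supp \<alpha>) Q"
    by (simp add: Phi_eq_sum[OF P \<alpha>] Phi_eq_sum[OF Q \<alpha>] sum_product)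
  finally show ?thesis .
qed

lemma of_length_iff: "of_length n P \<longleftrightarrow> (\<forall>k. dim_vec (P k) = n)"
  unfolding of_length_def using carrier_vecD carrier_vecI by blast

lemma of_length_pow: "of_length n P \<Longrightarrow> of_length (n ^ m) (tuple_pow P m)"
  by (simp add: of_length_iff tuple_pow_def)

lemma tuple_pow_Suc: "tuple_pow P (Suc m) = tuple_kron P (tuple_pow P m)"
  by (simp add: tuple_pow_def tuple_kron_def)

lemma tuple_pow_0: "tuple_pow P 0 = one_tuple"
  by (simp add: tuple_pow_def one_tuple_def)

lemma Phi_pow:
  assumes P: "of_length n P" and \<alpha>: "\<alpha> \<in> A_plus"
  shows "Phi \<alpha> (param_supp \<alpha>) (tuple_pow P m) = Phi \<alpha> (param_supp \<alpha>) P ^ m"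
proof (induction m)
  case 0
  have "of_length 1 (tuple_pow P 0)" using of_length_pow[OF P, of 0] by simp
  from Phi_eq_sum[OF this \<alpha>] show ?case by (simp add: tuple_pow_def)
next
  case (Suc m)
  show ?case unfolding tuple_pow_Suc Phi_kron[OF P of_length_pow[OF P] \<alpha>] Suc by simp
qed

lemma majorizes_kernelD:
  assumes PQ: "majorizes P Q" and P: "of_length n P"
  shows "\<exists>m W. of_length m Q \<and> (\<forall>i<m. \<forall>j<n. 0 \<le> W i j) \<and> (\<forall>j<n. (\<Sum>i<m. W i j) = 1) \<and>
    (\<forall>k. \<forall>i<m. Q k $ i = (\<Sum>j<n. W i j * P k $ j))"
proof -
  obtain T where T: "stochastic T" "of_length (dim_col T) P" "\<And>k. T *\<^sub>v P k = Q k"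
    using PQ unfolding majorizes_def maps_to_def by blast
  have c: "dim_col T = n" using T(2) P by (metis of_length_dim)
  have "of_length (dim_row T) Q" by (simp add: of_length_iff flip: T(3))
  moreover have "Q k $ i = (\<Sum>j<n. T $$ (i, j) * P k $ j)" if "i < dim_row T" for k i
    using that P c unfolding T(3)[symmetric]
    by (simp add: scalar_prod_def of_length_dim lessThan_atLeast0)
  ultimately show ?thesis using T(1) c unfolding stochastic_def
    by (intro exI[of _ "dim_row T"] exI[of _ "\<lambda>i j. T $$ (i, j)"]) auto
qed

text \<open>The unit mass of each column of the stochastic matrix is distributed over the target
  rows \<open>i\<close>; superadditivity of the weighted geometric mean then applies in each of
  them.\<close>

lemma Phi_majorizes_mono:
  assumes PQ: "majorizes P Q" and n: "of_length n P" and P: "\<And>k i. i < n \<Longrightarrow> 0 \<le> P k $ i"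
    and \<alpha>: "\<alpha> \<in> A_plus"
  shows "Phi \<alpha> (param_supp \<alpha>) P \<le> Phi \<alpha> (param_supp \<alpha>) Q"
proof -
  obtain m T where m: "of_length m Q" and T0: "\<And>i j. i < m \<Longrightarrow> j < n \<Longrightarrow> 0 \<le> T i j"
    and T1: "\<And>j. j < n \<Longrightarrow> (\<Sum>i<m. T i j) = 1"
    and Qi: "\<And>k i. i < m \<Longrightarrow> Q k $ i = (\<Sum>j<n. T i j * P k $ j)"
    using majorizes_kernelD[OF PQ n] by metis
  let ?g = "\<lambda>j. \<Prod>k\<in>param_supp \<alpha>. (P k $ j) powr \<alpha> k"
  have "Phi \<alpha> (param_supp \<alpha>) P = (\<Sum>j<n. (\<Sum>i<m. T i j) * ?g j)"
    by (simp add: Phi_eq_sum[OF n \<alpha>] T1)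
  also have "\<dots> = (\<Sum>i<m. \<Sum>j<n. T i j * ?g j)"
    unfolding sum_distrib_right by (rule sum.swap)
  also have "\<dots> \<le> (\<Sum>i<m. \<Prod>k\<in>param_supp \<alpha>. (\<Sum>j<n. T i j * P k $ j) powr \<alpha> k)"
    using A_plus_supp[OF \<alpha>] T0 P
    by (intro sum_mono weighted_geometric_mean_superadditive) auto
  also have "\<dots> = Phi \<alpha> (param_supp \<alpha>) Q"
    by (simp add: Phi_eq_sum[OF m \<alpha>] Qi)
  finally show ?thesis .
qed

section \<open>Probability tuples and limits in the l1-distance\<close>

lemma prob_tuple_length: "prob_tuple P \<Longrightarrow> \<exists>n. of_length n P"
  by (simp add: prob_tuple_def)

lemma prob_tuple_nonneg: "prob_tuple P \<Longrightarrow> of_length n P \<Longrightarrow> i < n \<Longrightarrow> 0 \<le> P k $ i"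
  by (auto simp: prob_tuple_def prob_vec_def of_length_dim)

lemma prob_tuple_sum: "prob_tuple P \<Longrightarrow> of_length n P \<Longrightarrow> (\<Sum>i<n. P k $ i) = 1"
  by (auto simp: prob_tuple_def prob_vec_def of_length_dim)

lemma prob_tupleI:
  "of_length n P \<Longrightarrow> (\<And>k i. i < n \<Longrightarrow> 0 \<le> P k $ i) \<Longrightarrow> (\<And>k. (\<Sum>i<n. P k $ i) = 1) \<Longrightarrow> prob_tuple P"
  by (auto simp: prob_tuple_def prob_vec_def of_length_dim)

lemma Phi_pos:
  assumes "prob_tuple P" and "common_supp P UNIV \<noteq> {}" and \<alpha>: "\<alpha> \<in> A_plus"
  shows "0 < Phi \<alpha> (param_supp \<alpha>) P"
proof -
  obtain n where n: "of_length n P" using assms prob_tuple_length by blast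
  obtain i where i: "i < n" "\<And>k. P k $ i \<noteq> 0"
    using assms(2) common_supp_iff[OF n] by blast
  have "0 < (\<Prod>k\<in>param_supp \<alpha>. (P k $ i) powr \<alpha> k)"
    using i by (intro prod_pos) simp
  also have "\<dots> \<le> (\<Sum>i<n. \<Prod>k\<in>param_supp \<alpha>. (P k $ i) powr \<alpha> k)"
    by (rule member_le_sum) (use i in \<open>auto intro: prod_nonneg\<close>)
  finally show ?thesis by (simp add: Phi_eq_sum[OF n \<alpha>])
qed

text \<open>\<open>R\<close> may be much longer than \<open>Q\<close>. By AM-GM the rows beyond the
  length of \<open>Q\<close> contribute at most the \<alpha>-average of the mass that the columns of
  \<open>R\<close> carry there, and this mass is part of the l1-distance.\<close>

lemma Phi_le_restrict_l1:
  assumes Q: "prob_tuple Q" "of_length n Q" and R: "prob_tuple R" and \<alpha>: "\<alpha> \<in> A_plus"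
    and d: "\<And>k. l1_dist (Q k) (R k) \<le> \<epsilon>"
  shows "Phi \<alpha> (param_supp \<alpha>) R \<le> (\<Sum>i<n. \<Prod>k\<in>param_supp \<alpha>. entry0 (R k) i powr \<alpha> k) + \<epsilon>"
proof -
  obtain n' where n': "of_length n' R" using prob_tuple_length[OF R] by blast
  let ?S = "param_supp \<alpha>"
  let ?g = "\<lambda>i. \<Prod>k\<in>?S. entry0 (R k) i powr \<alpha> k"
  note S = A_plus_supp[OF \<alpha>]
  have R0: "0 \<le> entry0 (R k) i" for k i
    using prob_tuple_nonneg[OF R n'] n' by (simp add: entry0_def of_length_dim)
  define M where "M = max n n'"
  have "Phi \<alpha> ?S R = (\<Sum>i<n'. ?g i)"
    unfolding Phi_eq_sum[OF n' \<alpha>] by (intro sum.cong refl) (use n' in \<open>simp add: entry0_def of_length_dim\<close>)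
  also have "\<dots> \<le> (\<Sum>i<M. ?g i)"
    by (rule sum_mono2) (auto simp: M_def intro: prod_nonneg)
  also have "{..<M} = {..<n} \<union> {n..<M}" by (auto simp: M_def)
  then have "(\<Sum>i<M. ?g i) = (\<Sum>i<n. ?g i) + (\<Sum>i\<in>{n..<M}. ?g i)"
    by (simp only: sum.union_disjoint finite_lessThan finite_atLeastLessThan ivl_disj_int)
  also have "(\<Sum>i\<in>{n..<M}. ?g i) \<le> (\<Sum>i\<in>{n..<M}. \<Sum>k\<in>?S. \<alpha> k * entry0 (R k) i)"
    using S R0 by (intro sum_mono weighted_am_gm) auto
  also have "\<dots> = (\<Sum>k\<in>?S. \<alpha> k * (\<Sum>i\<in>{n..<M}. entry0 (R k) i))"
    by (subst sum.swap) (simp add: sum_distrib_left)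
  also have "\<dots> \<le> (\<Sum>k\<in>?S. \<alpha> k * \<epsilon>)"
  proof (intro sum_mono mult_left_mono)
    fix k assume k: "k \<in> ?S"
    have "(\<Sum>i\<in>{n..<M}. entry0 (R k) i) = (\<Sum>i\<in>{n..<M}. \<bar>entry0 (Q k) i - entry0 (R k) i\<bar>)"
      by (intro sum.cong refl) (use Q(2) R0[of k] in \<open>simp add: entry0_def[of "Q k"] of_length_dim\<close>)
    also have "\<dots> \<le> (\<Sum>i<M. \<bar>entry0 (Q k) i - entry0 (R k) i\<bar>)"
      by (rule sum_mono2) auto
    also have "\<dots> = l1_dist (Q k) (R k)"
      using Q(2) n' by (simp add: l1_dist_def M_def of_length_dim)
    finally show "(\<Sum>i\<in>{n..<M}. entry0 (R k) i) \<le> \<epsilon>" using d[of k] by linarith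
  qed (use S in \<open>simp add: less_imp_le\<close>)
  also have "(\<Sum>k\<in>?S. \<alpha> k * \<epsilon>) = \<epsilon>" using S by (simp flip: sum_distrib_right)
  finally show ?thesis by linarith
qed

text \<open>The approximants have no common length, but up to an error \<epsilon> only the first
  \<open>n\<close> rows count, and there the entries converge.\<close>

lemma Phi_l1_limit:
  fixes Q :: "'d::finite vtuple"
  assumes Q: "prob_tuple Q" and \<alpha>: "\<alpha> \<in> A_plus"
    and approx: "\<And>\<epsilon>. 0 < \<epsilon> \<Longrightarrow> \<exists>R. prob_tuple R \<and> (\<forall>k. l1_dist (Q k) (R k) \<le> \<epsilon>) \<and> c \<le> Phi \<alpha> (param_supp \<alpha>) R"
  shows "c \<le> Phi \<alpha> (param_supp \<alpha>) Q"
proof -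
  obtain n where n: "of_length n Q" using prob_tuple_length[OF Q] by blast
  let ?e = "\<lambda>m. 1 / real (Suc m)"
  let ?S = "param_supp \<alpha>"
  note S = A_plus_supp[OF \<alpha>]
  have "\<forall>m. \<exists>R. prob_tuple R \<and> (\<forall>k. l1_dist (Q k) (R k) \<le> ?e m) \<and> c \<le> Phi \<alpha> ?S R"
    using approx by simp
  then obtain R where R: "\<And>m. prob_tuple (R m)" "\<And>m k. l1_dist (Q k) (R m k) \<le> ?e m"
    "\<And>m. c \<le> Phi \<alpha> ?S (R m)" by metis
  have le: "c \<le> (\<Sum>i<n. \<Prod>k\<in>?S. entry0 (R m k) i powr \<alpha> k) + ?e m" for m
    using R(3)[of m] Phi_le_restrict_l1[OF Q n R(1) \<alpha> R(2), of m] by linarith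
  have R0: "0 \<le> entry0 (R m k) i" for m k i
    using R(1)[of m] prob_tuple_length[OF R(1)[of m]]
    by (auto simp: entry0_def of_length_dim prob_tuple_nonneg)
  have e0: "?e \<longlonglongrightarrow> 0" using LIMSEQ_inverse_real_of_nat by (simp add: inverse_eq_divide)
  have lim: "(\<lambda>m. entry0 (R m k) i) \<longlonglongrightarrow> Q k $ i" if i: "i < n" for k i
  proof -
    have "\<bar>Q k $ i - entry0 (R m k) i\<bar> \<le> ?e m" for m
    proof -
      have "\<bar>entry0 (Q k) i - entry0 (R m k) i\<bar> \<le> l1_dist (Q k) (R m k)"
        unfolding l1_dist_def by (rule member_le_sum) (use i n in \<open>auto simp: of_length_dim\<close>)
      then show ?thesis using R(2)[of k m] i n by (simp add: entry0_def of_length_dim)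
    qed
    then have "(\<lambda>m. Q k $ i - entry0 (R m k) i) \<longlonglongrightarrow> 0"
      by (intro tendsto_rabs_zero_cancel[OF real_tendsto_sandwich[OF _ _ tendsto_const e0]] always_eventually) auto
    from tendsto_diff[OF tendsto_const[of "Q k $ i"] this] show ?thesis by simp
  qed
  \<comment> \<open>A limit base 0 does no harm to \<open>powr\<close>, because the bases are
    nonnegative and all exponents in the support are positive.\<close>
  have "(\<lambda>m. (\<Sum>i<n. \<Prod>k\<in>?S. entry0 (R m k) i powr \<alpha> k) + ?e m) \<longlonglongrightarrow>
      (\<Sum>i<n. \<Prod>k\<in>?S. (Q k $ i) powr \<alpha> k) + 0"
    using S(1) R0 lim
    by (intro tendsto_add tendsto_sum tendsto_prod e0 tendsto_powr2 tendsto_const always_eventually) auto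
  then have "c \<le> (\<Sum>i<n. \<Prod>k\<in>?S. (Q k $ i) powr \<alpha> k) + 0"
    by (rule LIMSEQ_le_const) (use le in blast)
  then show ?thesis by (simp add: Phi_eq_sum[OF n \<alpha>])
qed

subsection \<open>Filling up\<close>

lemma majorizes_kernelI:
  assumes P: "of_length n P" and Q: "of_length m Q"
    and W: "\<And>i j. i < m \<Longrightarrow> j < n \<Longrightarrow> 0 \<le> W i j" "\<And>j. j < n \<Longrightarrow> (\<Sum>i<m. W i j) = 1"
    and eq: "\<And>k i. i < m \<Longrightarrow> (\<Sum>j<n. W i j * P k $ j) = Q k $ i"
  shows "majorizes P Q"
proof -
  define T :: "real mat" where "T = mat m n (\<lambda>(i, j). W i j)"
  have "stochastic T" unfolding stochastic_def T_def using W by auto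
  moreover have "T *\<^sub>v P k = Q k" for k
  proof (rule eq_vecI)
    fix i assume "i < dim_vec (Q k)"
    then have i: "i < m" using Q by (simp add: of_length_dim)
    then show "(T *\<^sub>v P k) $ i = Q k $ i"
      using P eq[OF i, of k] by (simp add: T_def scalar_prod_def of_length_dim lessThan_atLeast0)
  qed (use Q in \<open>simp add: T_def of_length_dim\<close>)
  ultimately show ?thesis unfolding majorizes_def maps_to_def
    using P by (intro exI[of _ T]) (simp add: T_def)
qed

text \<open>The rows outside \<open>B\<close>, each of which charges a single column, can be used to fill up
  column by column whatever the image of the rows in \<open>B\<close> leaves of \<open>Q\<close>; the column sums match.\<close>

lemma majorizes_by_filling:
  fixes P Q :: "'d vtuple"
  assumes P: "prob_tuple P" "of_length n P" and Q: "prob_tuple Q" "of_length m Q"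
    and B: "B \<subseteq> {..<n}"
    and W: "\<And>i j. i < m \<Longrightarrow> j \<in> B \<Longrightarrow> 0 \<le> W i j" "\<And>j. j \<in> B \<Longrightarrow> (\<Sum>i<m. W i j) = 1"
    and le: "\<And>k i. i < m \<Longrightarrow> (\<Sum>j\<in>B. W i j * P k $ j) \<le> Q k $ i"
    and single: "\<And>j. j < n \<Longrightarrow> j \<notin> B \<Longrightarrow> \<exists>k. \<forall>l. l \<noteq> k \<longrightarrow> P l $ j = 0"
  shows "majorizes P Q"
proof -
  note P0 = prob_tuple_nonneg[OF P] and P1 = prob_tuple_sum[OF P] and Q1 = prob_tuple_sum[OF Q]
  have fin: "finite B" using B finite_subset by blast
  define D where "D = {..<n} - B"
  have split: "(\<Sum>j<n. f j) = (\<Sum>j\<in>B. f j) + (\<Sum>j\<in>D. f j)" for f :: "nat \<Rightarrow> real"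
    using sum.subset_diff[OF B, of f] by (simp add: D_def add.commute)
  obtain col where col: "\<And>j l. j \<in> D \<Longrightarrow> l \<noteq> col j \<Longrightarrow> P l $ j = 0"
    using single unfolding D_def by (metis DiffE lessThan_iff)
  define R where "R k i = Q k $ i - (\<Sum>j\<in>B. W i j * P k $ j)" for k i
  have R0: "0 \<le> R k i" if "i < m" for k i using le[OF that] by (simp add: R_def)
  define M where "M k = (\<Sum>j\<in>D. P k $ j)" for k
  \<comment> \<open>In each column the room left in \<open>Q\<close> equals the mass not yet sent,
    since the columns of \<open>P\<close> and \<open>Q\<close> sum to 1 and \<open>W\<close>
    preserves mass.\<close>
  have RM: "(\<Sum>i<m. R k i) = M k" for k
  proof -
    have "(\<Sum>i<m. \<Sum>j\<in>B. W i j * P k $ j) = (\<Sum>j\<in>B. (\<Sum>i<m. W i j) * P k $ j)"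
      unfolding sum_distrib_right by (rule sum.swap)
    also have "\<dots> = (\<Sum>j\<in>B. P k $ j)" using W(2) by simp
    finally show ?thesis
      using P1[of k] Q1[of k] split[of "\<lambda>j. P k $ j"] by (simp add: R_def M_def sum_subtractf)
  qed
  \<comment> \<open>A row outside \<open>B\<close> is spread in proportion to the room left in its
    own column. If \<open>M (col j) = 0\<close>, the row is zero altogether, and sending it to row 0
    only keeps \<open>V\<close> stochastic.\<close>
  define V where "V i j = (if j \<in> B then W i j
      else if M (col j) = 0 then (if i = 0 then 1 else 0) else R (col j) i / M (col j))" for i j
  have M0: "0 \<le> M k" for k unfolding M_def D_def by (intro sum_nonneg P0) auto
  have m: "0 < m" using Q1 by (metis lessThan_0 neq0_conv sum.empty zero_neq_one)
  show ?thesis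
  proof (rule majorizes_kernelI[OF P(2) Q(2), where W = V])
    show "0 \<le> V i j" if "i < m" "j < n" for i j
      using W(1) R0 M0 that by (auto simp: V_def)
    show "(\<Sum>i<m. V i j) = 1" if "j < n" for j
    proof (cases "j \<in> B")
      case True
      then show ?thesis using W(2) by (simp add: V_def)
    next
      case False
      show ?thesis
      proof (cases "M (col j) = 0")
        case True
        have "(\<Sum>i<m. V i j) = (\<Sum>i<m. if i = 0 then 1 else 0)"
          using False True by (simp add: V_def)
        also have "\<dots> = 1" using m by (simp add: sum.delta)
        finally show ?thesis .
      next
        case nz: False
        have "(\<Sum>i<m. V i j) = (\<Sum>i<m. R (col j) i / M (col j))"
          using False nz by (simp add: V_def)
        also have "\<dots> = 1" using nz by (simp add: RM flip: sum_divide_distrib)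
        finally show ?thesis .
      qed
    qed
    show "(\<Sum>j<n. V i j * P k $ j) = Q k $ i" if i: "i < m" for k i
    proof -
      have "(\<Sum>j\<in>D. V i j * P k $ j) = R k i"
      proof (cases "M k = 0")
        case True
        then have "P k $ j = 0" if "j \<in> D" for j
          using that P0 unfolding M_def D_def by (subst (asm) sum_nonneg_eq_0_iff) auto
        moreover have "R k i = 0"
        proof -
          have "(\<Sum>i<m. R k i) = 0" using RM[of k] True by simp
          then have "\<forall>i\<in>{..<m}. R k i = 0"
            by (subst (asm) sum_nonneg_eq_0_iff) (use R0 in auto)
          then show ?thesis using i by simp
        qed
        ultimately show ?thesis by simp
      next
        case False
        have "V i j * P k $ j = R k i / M k * P k $ j" if "j \<in> D" for j
        proof (cases "col j = k")
          case True
          then show ?thesis using that False by (simp add: V_def D_def)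
        next
          case ne: False
          then show ?thesis using col[OF that, of k] by simp
        qed
        then have "(\<Sum>j\<in>D. V i j * P k $ j) = (\<Sum>j\<in>D. R k i / M k * P k $ j)" by simp
        also have "\<dots> = R k i / M k * M k" by (simp add: M_def sum_distrib_left)
        finally show ?thesis using False by simp
      qed
      moreover have "(\<Sum>j\<in>B. V i j * P k $ j) = (\<Sum>j\<in>B. W i j * P k $ j)"
        by (simp add: V_def)
      ultimately show ?thesis by (simp add: split R_def)
    qed
  qed
qed

subsection \<open>Tilted laws\<close>

text \<open>A closed part of the unit cube, which is compact in the product topology by Tychonoff's
  theorem.\<close>

lemma compact_simplex:
  "compact {\<alpha> :: 'd::finite \<Rightarrow> real. \<alpha> \<in> A_plus \<and> param_supp \<alpha> \<subseteq> C}"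
proof -
  have "compactin (product_topology (\<lambda>_::'d. euclidean) UNIV) (Pi\<^sub>E UNIV (\<lambda>_. {0..1::real}))"
    by (simp add: compactin_PiE)
  then have box: "compact (Pi\<^sub>E UNIV (\<lambda>_::'d. {0..1::real}))"
    by (simp add: euclidean_product_topology)
  have coord: "continuous_on UNIV (\<lambda>\<alpha> :: 'd \<Rightarrow> real. \<alpha> k)" for k
    by (rule continuous_on_product_coordinates)
  have "closed {\<alpha> :: 'd \<Rightarrow> real. (\<Sum>k\<in>UNIV. \<alpha> k) = 1}"
    by (intro closed_Collect_eq continuous_on_sum coord continuous_on_const)
  moreover have "closed (\<Inter>k\<in>-C. {\<alpha> :: 'd \<Rightarrow> real. \<alpha> k = 0})"
    by (intro closed_INT ballI closed_Collect_eq coord continuous_on_const)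
  ultimately have "compact (Pi\<^sub>E UNIV (\<lambda>_::'d. {0..1::real}) \<inter>
      ({\<alpha>. (\<Sum>k\<in>UNIV. \<alpha> k) = 1} \<inter> (\<Inter>k\<in>-C. {\<alpha>. \<alpha> k = 0})))"
    by (intro compact_Int_closed[OF box] closed_Int)
  also have "Pi\<^sub>E UNIV (\<lambda>_::'d. {0..1::real}) \<inter>
      ({\<alpha>. (\<Sum>k\<in>UNIV. \<alpha> k) = 1} \<inter> (\<Inter>k\<in>-C. {\<alpha>. \<alpha> k = 0})) =
      {\<alpha>. \<alpha> \<in> A_plus \<and> param_supp \<alpha> \<subseteq> C}"
  proof -
    have "\<alpha> k \<le> 1" if "(\<Sum>k\<in>UNIV. \<alpha> k) = 1" "\<forall>k. 0 \<le> \<alpha> k" for \<alpha> :: "'d \<Rightarrow> real" and k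
      using that member_le_sum[of k UNIV \<alpha>] by simp
    then show ?thesis by (auto simp: A_plus_def param_supp_def)
  qed
  finally show ?thesis .
qed

lemma unit_param_A_plus: "unit_param k \<in> A_plus"
  by (simp add: A_plus_def unit_param_def)

lemma param_supp_unit_param [simp]: "param_supp (unit_param k) = {k}"
  by (auto simp: param_supp_def unit_param_def)

text \<open>The parameter \<open>\<alpha>\<close> minimizes \<open>ln F \<alpha> + \<alpha> \<bullet> v\<close> over the simplex spanned by \<open>C\<close>. The bound is
  the first order condition in the direction of the vertex \<open>k\<close>, read slightly beyond \<open>\<alpha>\<close> on the
  opposite side.\<close>

lemma minimizing_parameter:
  fixes L :: "nat \<Rightarrow> 'd::finite \<Rightarrow> real"
  assumes C: "C \<noteq> {}" and m: "0 < m"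
  defines "F \<equiv> \<lambda>\<beta>. \<Sum>i<m. exp (\<Sum>k\<in>UNIV. \<beta> k * L i k)"
  shows "\<exists>\<alpha>\<in>A_plus. param_supp \<alpha> \<subseteq> C \<and> (\<forall>k\<in>C. \<forall>\<eta>>0. \<exists>s>0.
    F (\<lambda>l. \<alpha> l + s * (\<alpha> l - unit_param k l)) \<le> F \<alpha> * exp (s * (v k - (\<Sum>l\<in>UNIV. \<alpha> l * v l) + \<eta>)))"
proof -
  let ?D = "{\<alpha> :: 'd \<Rightarrow> real. \<alpha> \<in> A_plus \<and> param_supp \<alpha> \<subseteq> C}"
  define g where "g \<alpha> = ln (F \<alpha>) + (\<Sum>l\<in>UNIV. \<alpha> l * v l)" for \<alpha>
  have F0: "0 < F \<beta>" for \<beta> unfolding F_def using m by (intro sum_pos) auto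
  have coord: "continuous_on A (\<lambda>\<alpha> :: 'd \<Rightarrow> real. \<alpha> k)" for k A
    by (rule continuous_on_subset[OF continuous_on_product_coordinates]) simp
  have cont: "continuous_on ?D g"
    unfolding g_def
    by (intro continuous_on_add continuous_on_ln continuous_on_sum continuous_on_mult continuous_on_const coord)
      (use F0 in \<open>auto simp: F_def less_imp_neq[symmetric] intro!: continuous_on_sum continuous_on_exp continuous_on_mult continuous_on_const coord\<close>)
  obtain k0 where "k0 \<in> C" using C by auto
  then have "unit_param k0 \<in> ?D" by (simp add: unit_param_A_plus)
  then have "?D \<noteq> {}" by blast
  from continuous_attains_inf[OF compact_simplex this cont]
  obtain \<alpha> where \<alpha>: "\<alpha> \<in> A_plus" "param_supp \<alpha> \<subseteq> C"
    and min: "\<And>\<beta>. \<beta> \<in> A_plus \<Longrightarrow> param_supp \<beta> \<subseteq> C \<Longrightarrow> g \<alpha> \<le> g \<beta>" by auto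
  have "\<exists>s>0. F (\<lambda>l. \<alpha> l + s * (\<alpha> l - unit_param k l)) \<le> F \<alpha> * exp (s * (v k - (\<Sum>l\<in>UNIV. \<alpha> l * v l) + \<eta>))"
    if k: "k \<in> C" and \<eta>: "0 < \<eta>" for k \<eta>
  proof -
    define a where "a i = (\<Sum>l\<in>UNIV. \<alpha> l * L i l)" for i
    define b where "b i = L i k - a i" for i
    define c where "c = v k - (\<Sum>l\<in>UNIV. \<alpha> l * v l)"
    \<comment> \<open>The line from \<alpha> at \<open>t = 0\<close> to the vertex \<open>k\<close>
      at \<open>t = 1\<close>; negative \<open>t\<close> lies beyond \<alpha> and may leave the
      simplex.\<close>
    let ?\<gamma> = "\<lambda>t l. \<alpha> l + t * (unit_param k l - \<alpha> l)"
    have lin: "(\<Sum>l\<in>UNIV. ?\<gamma> t l * u l) = (\<Sum>l\<in>UNIV. \<alpha> l * u l) + t * (u k - (\<Sum>l\<in>UNIV. \<alpha> l * u l))" for t u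
    proof -
      have "(\<Sum>l\<in>UNIV. ?\<gamma> t l * u l) =
        (\<Sum>l\<in>UNIV. \<alpha> l * u l + t * ((if l = k then u l else 0) - \<alpha> l * u l))"
        by (intro sum.cong refl) (simp add: unit_param_def algebra_simps)
      then show ?thesis by (simp add: sum.distrib sum_subtractf flip: sum_distrib_left)
    qed
    have F\<gamma>: "F (?\<gamma> t) = (\<Sum>i<m. exp (a i + t * b i))" for t
      unfolding F_def lin by (simp add: a_def b_def)
    define D where "D = (\<Sum>i<m. exp (a i) * b i) / F \<alpha>"
    have F\<alpha>: "F \<alpha> = (\<Sum>i<m. exp (a i))" by (simp add: F_def a_def)
    have der: "((\<lambda>t. ln (F (?\<gamma> t)) + t * e) has_real_derivative D + e) (at 0)" for e
    proof -
      have "((\<lambda>t. exp (a i + t * b i)) has_real_derivative exp (a i) * b i) (at 0)" for i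
        by (auto intro!: derivative_eq_intros)
      then have "((\<lambda>t. \<Sum>i<m. exp (a i + t * b i)) has_real_derivative (\<Sum>i<m. exp (a i) * b i)) (at 0)"
        by (intro DERIV_sum) auto
      moreover have "(\<Sum>i<m. exp (a i + 0 * b i)) = F \<alpha>" by (simp add: F\<alpha>)
      ultimately have "((\<lambda>t. ln (\<Sum>i<m. exp (a i + t * b i))) has_real_derivative
          inverse (F \<alpha>) * (\<Sum>i<m. exp (a i) * b i)) (at 0)"
        using DERIV_chain2[where f = ln and g = "\<lambda>t. \<Sum>i<m. exp (a i + t * b i)" and x = 0] DERIV_ln[OF F0[of \<alpha>]]
        by simp
      then have "((\<lambda>t. ln (F (?\<gamma> t))) has_real_derivative D) (at 0)"
        unfolding F\<gamma> by (simp add: D_def divide_inverse mult.commute)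
      moreover have "((\<lambda>t. t * e) has_real_derivative e) (at 0)"
        by (auto intro!: derivative_eq_intros)
      ultimately show ?thesis by (rule DERIV_add)
    qed
    \<comment> \<open>Otherwise a short move towards the vertex \<open>k\<close>, which stays in the
      simplex, would decrease the minimized function \<open>g\<close>.\<close>
    have "0 \<le> D + c"
    proof (rule ccontr)
      assume "\<not> 0 \<le> D + c"
      then obtain d where d: "d > 0" "\<And>h. 0 < h \<Longrightarrow> h < d \<Longrightarrow>
          ln (F (?\<gamma> (0 + h))) + (0 + h) * c < ln (F (?\<gamma> 0)) + 0 * c"
        using DERIV_neg_dec_right[OF der[of c]] by auto
      define h where "h = min (d / 2) 1"
      have h: "0 < h" "h < d" "h \<le> 1" using d(1) by (auto simp: h_def)
      have "ln (F (?\<gamma> h)) + h * c < ln (F \<alpha>)" using d(2)[OF h(1,2)] by simp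
      then have "g (?\<gamma> h) < g \<alpha>"
        unfolding g_def lin[of h v] by (simp add: c_def)
      moreover have "?\<gamma> h \<in> A_plus"
      proof -
        have "(\<Sum>l\<in>UNIV. ?\<gamma> h l) = 1"
          using lin[of h "\<lambda>_. 1"] \<alpha>(1) by (simp add: A_plus_def)
        moreover have "?\<gamma> h l = (1 - h) * \<alpha> l + h * unit_param k l" for l
          by (simp add: algebra_simps)
        ultimately show ?thesis using \<alpha>(1) h unfolding A_plus_def by (simp add: unit_param_def)
      qed
      moreover have "param_supp (?\<gamma> h) \<subseteq> C"
        using \<alpha>(2) k by (auto simp: param_supp_def unit_param_def)
      ultimately show False using min[of "?\<gamma> h"] by simp
    qed
    \<comment> \<open>The slack \<eta> makes the slope strictly positive, so that the function is
      strictly smaller just to the left of 0, at \<open>t = - s\<close>.\<close>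
    then have "0 < D + (c + \<eta>)" using \<eta> by simp
    from DERIV_pos_inc_left[OF der this]
    obtain d where d: "d > 0" "\<And>h. 0 < h \<Longrightarrow> h < d \<Longrightarrow>
        ln (F (?\<gamma> (0 - h))) + (0 - h) * (c + \<eta>) < ln (F (?\<gamma> 0)) + 0 * (c + \<eta>)" by auto
    define s where "s = d / 2"
    have s: "0 < s" "s < d" using d(1) by (auto simp: s_def)
    have eq: "?\<gamma> (0 - s) = (\<lambda>l. \<alpha> l + s * (\<alpha> l - unit_param k l))"
      by (auto simp: algebra_simps)
    have "ln (F (\<lambda>l. \<alpha> l + s * (\<alpha> l - unit_param k l))) < ln (F \<alpha>) + s * (c + \<eta>)"
      using d(2)[OF s] unfolding eq by simp
    then have "F (\<lambda>l. \<alpha> l + s * (\<alpha> l - unit_param k l)) < exp (ln (F \<alpha>) + s * (c + \<eta>))"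
      using F0 by (metis exp_less_cancel_iff exp_ln)
    then show ?thesis using s(1) F0 by (intro exI[of _ s]) (simp add: exp_add c_def)
  qed
  then show ?thesis using \<alpha> by (intro bexI[of _ \<alpha>]) blast+
qed

section \<open>A Chernoff bound for powers of tilted distributions\<close>

lemma sum_UN_le:
  fixes f :: "'b \<Rightarrow> real"
  assumes "finite C" "\<And>k. k \<in> C \<Longrightarrow> finite (B k)" "\<And>k x. k \<in> C \<Longrightarrow> x \<in> B k \<Longrightarrow> 0 \<le> f x"
  shows "sum f (\<Union>k\<in>C. B k) \<le> (\<Sum>k\<in>C. sum f (B k))"
  using assms
proof (induction C rule: finite_induct)
  case (insert k C)
  have "sum f (B k \<union> (\<Union>k\<in>C. B k)) + sum f (B k \<inter> (\<Union>k\<in>C. B k)) = sum f (B k) + sum f (\<Union>k\<in>C. B k)"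
    using insert by (intro sum.union_inter) auto
  moreover have "0 \<le> sum f (B k \<inter> (\<Union>k\<in>C. B k))"
    using insert.prems by (intro sum_nonneg) auto
  moreover have "sum f (\<Union>k\<in>C. B k) \<le> (\<Sum>k\<in>C. sum f (B k))"
    using insert.IH insert.prems by blast
  ultimately show ?case using insert.hyps by simp
qed simp

text \<open>In the exponential form the function makes sense for all real parameters, also for those
  beyond the simplex that the first order condition uses.\<close>

lemma Phi_eq_exp_sum:
  assumes Q: "of_length m Q" "\<And>k i. i < m \<Longrightarrow> 0 < Q k $ i" and \<alpha>: "\<alpha> \<in> A_plus"
  shows "Phi \<alpha> (param_supp \<alpha>) Q = (\<Sum>i<m. exp (\<Sum>k\<in>UNIV. \<alpha> k * ln (Q k $ i)))"
proof -
  have "(\<Prod>k\<in>param_supp \<alpha>. (Q k $ i) powr \<alpha> k) = exp (\<Sum>k\<in>UNIV. \<alpha> k * ln (Q k $ i))" if i: "i < m" for i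
  proof -
    have "(\<Prod>k\<in>param_supp \<alpha>. (Q k $ i) powr \<alpha> k) = exp (\<Sum>k\<in>param_supp \<alpha>. \<alpha> k * ln (Q k $ i))"
      using Q(2)[OF i] by (simp add: exp_sum powr_def less_imp_neq[symmetric])
    also have "(\<Sum>k\<in>param_supp \<alpha>. \<alpha> k * ln (Q k $ i)) = (\<Sum>k\<in>UNIV. \<alpha> k * ln (Q k $ i))"
      by (rule sum.mono_neutral_left) (auto simp: param_supp_def)
    finally show ?thesis .
  qed
  then show ?thesis by (simp add: Phi_eq_sum[OF Q(1) \<alpha>])
qed

text \<open>The law \<open>w\<close> is a power of the tilted distribution \<open>\<mu> i \<propto> \<Prod>\<^sub>k (Q k i) powr (\<alpha> k)\<close>, conditioned
  on the rows where its likelihood ratio with respect to each \<open>Q k\<close> with \<open>k \<in> C\<close> is not too large; a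
  Chernoff bound shows that this is an event of probability at least \<open>1/2\<close>.\<close>

lemma tilted_law:
  fixes Q :: "'d::finite vtuple"
  assumes Q: "of_length m Q" "\<And>k i. i < m \<Longrightarrow> 0 < Q k $ i" and m: "0 < m"
    and C: "C \<noteq> {}" and \<kappa>: "0 < \<kappa>"
  shows "\<exists>\<alpha>\<in>A_plus. param_supp \<alpha> \<subseteq> C \<and> (\<forall>\<^sub>F n in sequentially. \<exists>w.
    (\<forall>y. 0 \<le> w y) \<and> (\<Sum>y<m ^ n. w y) = 1 \<and>
    (\<forall>k\<in>C. \<forall>y<m ^ n. w y \<le> 2 * kron_pow (Q k) n $ y *
        (exp (v k - (\<Sum>l\<in>UNIV. \<alpha> l * v l) + \<kappa>) / Phi \<alpha> (param_supp \<alpha>) Q) ^ n))"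
proof -
  define L where "L i k = ln (Q k $ i)" for i k
  define F where "F \<beta> = (\<Sum>i<m. exp (\<Sum>k\<in>UNIV. \<beta> k * L i k))" for \<beta>
  obtain \<alpha> where \<alpha>: "\<alpha> \<in> A_plus" "param_supp \<alpha> \<subseteq> C"
    and tilt: "\<forall>k\<in>C. \<forall>\<eta>>0. \<exists>s>0. F (\<lambda>l. \<alpha> l + s * (\<alpha> l - unit_param k l)) \<le>
      F \<alpha> * exp (s * (v k - (\<Sum>l\<in>UNIV. \<alpha> l * v l) + \<eta>))"
    using minimizing_parameter[OF C m, of L v] unfolding F_def by blast
  define c where "c k = v k - (\<Sum>l\<in>UNIV. \<alpha> l * v l)" for k
  \<comment> \<open>Half of \<kappa> pays for the first order condition; the other half is left as
    the exponential rate of the Chernoff bound.\<close>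
  have "\<forall>k\<in>C. \<exists>s>0. F (\<lambda>l. \<alpha> l + s * (\<alpha> l - unit_param k l)) \<le> F \<alpha> * exp (s * (c k + \<kappa> / 2))"
    using tilt \<kappa> unfolding c_def by simp
  then obtain s where s: "\<And>k. k \<in> C \<Longrightarrow> 0 < s k"
    "\<And>k. k \<in> C \<Longrightarrow> F (\<lambda>l. \<alpha> l + s k * (\<alpha> l - unit_param k l)) \<le> F \<alpha> * exp (s k * (c k + \<kappa> / 2))"
    by metis
  have F0: "0 < F \<alpha>" unfolding F_def using m by (intro sum_pos) auto
  have F\<Phi>: "Phi \<alpha> (param_supp \<alpha>) Q = F \<alpha>"
    using Phi_eq_exp_sum[OF Q \<alpha>(1)] by (simp add: F_def L_def)
  define a where "a i = (\<Sum>k\<in>UNIV. \<alpha> k * L i k)" for i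
  define \<mu> where "\<mu> = vec m (\<lambda>i. exp (a i) / F \<alpha>)"
  define b where "b k = exp (c k + \<kappa>) / F \<alpha>" for k
  have b0: "0 < b k" for k using F0 by (simp add: b_def)
  \<comment> \<open>The summands of the moment of order \<open>s k\<close> of the normalized
    likelihood ratio under \<open>\<mu>\<close>. Moments of product laws multiply, so the powers of
    \<open>\<nu> k\<close> serve all \<open>n\<close>.\<close>
  define \<nu> where "\<nu> k = vec m (\<lambda>i. \<mu> $ i * (\<mu> $ i / (Q k $ i * b k)) powr s k)" for k
  have \<mu>0: "0 < \<mu> $ i" if "i < m" for i using that F0 by (simp add: \<mu>_def)
  have \<mu>_total: "vec_total \<mu> = 1"
    using F0 by (simp add: vec_total_def \<mu>_def F_def a_def flip: sum_divide_distrib)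
  have \<nu>_total: "vec_total (\<nu> k) \<le> exp (- s k * \<kappa> / 2)" if k: "k \<in> C" for k
  proof -
    have entry: "\<nu> k $ i = exp (\<Sum>l\<in>UNIV. (\<alpha> l + s k * (\<alpha> l - unit_param k l)) * L i l) / F \<alpha> * exp (- s k * (c k + \<kappa>))"
      if i: "i < m" for i
    proof -
      have ratio: "\<mu> $ i / (Q k $ i * b k) = exp (a i - L i k - (c k + \<kappa>))"
        using Q(2)[OF i, of k] F0 i by (simp add: \<mu>_def b_def exp_diff L_def)
      have "\<nu> k $ i = \<mu> $ i * (\<mu> $ i / (Q k $ i * b k)) powr s k" using i by (simp add: \<nu>_def)
      also have "\<dots> = exp (a i) / F \<alpha> * exp (s k * (a i - L i k - (c k + \<kappa>)))"
        unfolding ratio using i by (simp add: \<mu>_def powr_def)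
      also have "\<dots> = exp (a i + s k * (a i - L i k)) / F \<alpha> * exp (- s k * (c k + \<kappa>))"
        by (simp add: field_simps flip: exp_add)
      also have "a i + s k * (a i - L i k) = (\<Sum>l\<in>UNIV. (\<alpha> l + s k * (\<alpha> l - unit_param k l)) * L i l)"
      proof -
        have "(\<Sum>l\<in>UNIV. (\<alpha> l + s k * (\<alpha> l - unit_param k l)) * L i l) =
          (\<Sum>l\<in>UNIV. \<alpha> l * L i l + s k * (\<alpha> l * L i l - (if l = k then L i l else 0)))"
          by (intro sum.cong refl) (simp add: unit_param_def algebra_simps)
        then show ?thesis by (simp add: sum.distrib sum_subtractf a_def flip: sum_distrib_left)
      qed
      finally show ?thesis .
    qed
    have "vec_total (\<nu> k) = (\<Sum>i<m. exp (\<Sum>l\<in>UNIV. (\<alpha> l + s k * (\<alpha> l - unit_param k l)) * L i l) / F \<alpha> * exp (- s k * (c k + \<kappa>)))"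
      unfolding vec_total_def by (intro sum.cong) (simp_all add: entry, simp add: \<nu>_def)
    also have "\<dots> = F (\<lambda>l. \<alpha> l + s k * (\<alpha> l - unit_param k l)) / F \<alpha> * exp (- s k * (c k + \<kappa>))"
      by (simp add: F_def flip: sum_divide_distrib sum_distrib_right)
    also have "\<dots> \<le> exp (s k * (c k + \<kappa> / 2)) * exp (- s k * (c k + \<kappa>))"
      using s(2)[OF k] F0 by (intro mult_right_mono) (simp_all add: divide_simps mult.commute)
    also have "\<dots> = exp (- s k * \<kappa> / 2)" by (simp add: algebra_simps flip: exp_add)
    finally show ?thesis .
  qed
  define bad where "bad n k = {y. y < m ^ n \<and> kron_pow (Q k) n $ y * b k ^ n < kron_pow \<mu> n $ y}" for n k
  have \<nu>0: "0 \<le> kron_pow (\<nu> k) n $ y" if "y < m ^ n" for k n y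
    using that \<mu>0 by (intro kron_pow_nonneg) (auto simp: \<nu>_def less_imp_le)
  have \<mu>n0: "0 \<le> kron_pow \<mu> n $ y" if "y < m ^ n" for n y
    using that \<mu>0 by (intro kron_pow_nonneg) (auto simp: \<mu>_def less_imp_le)
  \<comment> \<open>Markov's inequality: on the bad rows the normalized likelihood ratio exceeds 1,
    so inserting its power \<open>s k\<close> only increases the sum.\<close>
  have bad_mass: "(\<Sum>y\<in>bad n k. kron_pow \<mu> n $ y) \<le> exp (- s k * \<kappa> / 2) ^ n" if k: "k \<in> C" for n k
  proof -
    have "(\<Sum>y\<in>bad n k. kron_pow \<mu> n $ y) \<le> (\<Sum>y\<in>bad n k. kron_pow (\<nu> k) n $ y)"
    proof (rule sum_mono)
      fix y assume "y \<in> bad n k"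
      then have y: "y < m ^ n" "kron_pow (Q k) n $ y * b k ^ n < kron_pow \<mu> n $ y" by (auto simp: bad_def)
      obtain d where d: "\<forall>t<n. d t < m" "\<And>p. dim_vec p = m \<Longrightarrow> kron_pow p n $ y = (\<Prod>t<n. p $ d t)"
        using kron_pow_digits[OF y(1)] by blast
      have Qn: "0 < kron_pow (Q k) n $ y * b k ^ n"
        using d Q b0 by (auto simp: of_length_dim intro!: mult_pos_pos prod_pos)
      have "kron_pow (\<nu> k) n $ y = (\<Prod>t<n. \<mu> $ d t * (\<mu> $ d t / (Q k $ d t * b k)) powr s k)"
        using d by (simp add: \<nu>_def)
      also have "\<dots> = kron_pow \<mu> n $ y * (kron_pow \<mu> n $ y / (kron_pow (Q k) n $ y * b k ^ n)) powr s k"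
        using d Q(1) by (simp add: of_length_dim \<mu>_def prod.distrib prod_dividef flip: prod_powr_distrib)
      finally have eq: "kron_pow (\<nu> k) n $ y =
        kron_pow \<mu> n $ y * (kron_pow \<mu> n $ y / (kron_pow (Q k) n $ y * b k ^ n)) powr s k" .
      have "1 \<le> (kron_pow \<mu> n $ y / (kron_pow (Q k) n $ y * b k ^ n)) powr s k"
        using Qn y(2) s(1)[OF k] by (intro ge_one_powr_ge_zero) (auto simp: divide_simps)
      then show "kron_pow \<mu> n $ y \<le> kron_pow (\<nu> k) n $ y"
        unfolding eq using \<mu>n0[OF y(1)] by (simp add: mult_le_cancel_left1)
    qed
    also have "\<dots> \<le> (\<Sum>y<m ^ n. kron_pow (\<nu> k) n $ y)"
      using \<nu>0 by (intro sum_mono2) (auto simp: bad_def)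
    also have "\<dots> = vec_total (\<nu> k) ^ n"
      by (simp add: \<nu>_def flip: vec_total_kron_pow) (simp add: vec_total_def)
    also have "\<dots> \<le> exp (- s k * \<kappa> / 2) ^ n"
      using \<nu>_total[OF k] \<mu>0 Q(2) by (intro power_mono) (auto simp: vec_total_def \<nu>_def less_imp_le intro!: sum_nonneg)
    finally show ?thesis .
  qed
  have "(\<lambda>n. \<Sum>k\<in>C. exp (- s k * \<kappa> / 2) ^ n) \<longlonglongrightarrow> (\<Sum>k\<in>C. 0)"
    using s(1) \<kappa> by (intro tendsto_sum LIMSEQ_realpow_zero) (auto simp: mult_pos_pos)
  then have "\<forall>\<^sub>F n in sequentially. (\<Sum>k\<in>C. exp (- s k * \<kappa> / 2) ^ n) < 1 / 2"
    by (rule order_tendstoD(2)) simp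
  then have "\<forall>\<^sub>F n in sequentially. \<exists>w. (\<forall>y. 0 \<le> w y) \<and> (\<Sum>y<m ^ n. w y) = 1 \<and>
    (\<forall>k\<in>C. \<forall>y<m ^ n. w y \<le> 2 * kron_pow (Q k) n $ y * b k ^ n)"
  proof eventually_elim
    case (elim n)
    define Bad where "Bad = (\<Union>k\<in>C. bad n k)"
    define G where "G = {..<m ^ n} - Bad"
    define \<gamma> where "\<gamma> = (\<Sum>y\<in>G. kron_pow \<mu> n $ y)"
    have Bad: "Bad \<subseteq> {..<m ^ n}" by (auto simp: Bad_def bad_def)
    have "(\<Sum>y\<in>Bad. kron_pow \<mu> n $ y) \<le> (\<Sum>k\<in>C. \<Sum>y\<in>bad n k. kron_pow \<mu> n $ y)"
      unfolding Bad_def using \<mu>n0 by (intro sum_UN_le) (auto simp: bad_def)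
    also have "\<dots> \<le> (\<Sum>k\<in>C. exp (- s k * \<kappa> / 2) ^ n)" by (intro sum_mono bad_mass)
    finally have "(\<Sum>y\<in>Bad. kron_pow \<mu> n $ y) \<le> 1 / 2" using elim by linarith
    moreover have "(\<Sum>y\<in>Bad. kron_pow \<mu> n $ y) + \<gamma> = 1"
    proof -
      have "(\<Sum>y\<in>Bad. kron_pow \<mu> n $ y) + \<gamma> = (\<Sum>y<m ^ n. kron_pow \<mu> n $ y)"
        unfolding \<gamma>_def G_def using sum.subset_diff[OF Bad, of "\<lambda>y. kron_pow \<mu> n $ y"] by simp
      also have "\<dots> = vec_total (kron_pow \<mu> n)" by (simp add: vec_total_def \<mu>_def)
      finally show ?thesis by (simp add: vec_total_kron_pow \<mu>_total)
    qed
    ultimately have \<gamma>: "1 / 2 \<le> \<gamma>" by linarith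
    \<comment> \<open>Conditioning on the good rows costs at most the factor
      \<open>1 / \<gamma> <= 2\<close>, which is the 2 in the bound.\<close>
    define w where "w y = (if y \<in> G then kron_pow \<mu> n $ y / \<gamma> else 0)" for y
    have "0 \<le> w y" for y using \<gamma> \<mu>n0 by (auto simp: w_def G_def)
    moreover have "(\<Sum>y<m ^ n. w y) = 1"
    proof -
      have "(\<Sum>y<m ^ n. w y) = (\<Sum>y\<in>G. kron_pow \<mu> n $ y / \<gamma>)"
        unfolding w_def by (subst sum.inter_restrict[symmetric]) (auto simp: G_def intro!: sum.cong)
      also have "\<dots> = 1" using \<gamma> by (simp add: \<gamma>_def flip: sum_divide_distrib)
      finally show ?thesis .
    qed
    moreover have "w y \<le> 2 * kron_pow (Q k) n $ y * b k ^ n" if k: "k \<in> C" and y: "y < m ^ n" for k y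
    proof (cases "y \<in> G")
      case True
      then have "kron_pow \<mu> n $ y \<le> kron_pow (Q k) n $ y * b k ^ n"
        using k y by (auto simp: G_def Bad_def bad_def)
      moreover have "kron_pow \<mu> n $ y / \<gamma> \<le> kron_pow \<mu> n $ y * 2"
      proof -
        have "1 / \<gamma> \<le> 2" using \<gamma> by (simp add: divide_simps)
        from mult_left_mono[OF this \<mu>n0[OF y]] show ?thesis by simp
      qed
      ultimately show ?thesis using True by (simp add: w_def)
    next
      case False
      have "0 \<le> kron_pow (Q k) n $ y"
        using y Q by (intro kron_pow_nonneg) (auto simp: of_length_dim less_imp_le)
      then show ?thesis using False b0[of k] by (simp add: w_def less_imp_le)
    qed
    ultimately show ?case by blast
  qed
  then show ?thesis using \<alpha> unfolding b_def c_def F\<Phi>[symmetric] by blast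
qed

text \<open>On the group, column \<open>l\<close> of \<open>C\<close> is about
  \<open>exp (- n * v l)\<close>. So the weighted geometric mean of the columns, which on these rows
  is the power of a vector \<open>u\<close> with total \<open>Phi \<alpha> C P\<close>, is at least
  \<open>exp (- n * (\<alpha> \<bullet> v + \<kappa>))\<close>. Comparing column \<open>k\<close>
  with it bounds the mass of the group by an \<open>n\<close>-th power.\<close>

lemma type_cell_mass:
  fixes P :: "'d::finite vtuple"
  assumes P: "of_length N P" "\<And>k i. i < N \<Longrightarrow> 0 \<le> P k $ i"
    and \<alpha>: "\<alpha> \<in> A_plus" "param_supp \<alpha> \<subseteq> C" and k: "k \<in> C"
    and A: "A \<subseteq> {..<N ^ n}"
    and cell: "\<And>l x. l \<in> C \<Longrightarrow> x \<in> A \<Longrightarrow> exp (- real n * (v l + \<kappa>)) \<le> kron_pow (P l) n $ x"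
      "\<And>l x. l \<in> C \<Longrightarrow> x \<in> A \<Longrightarrow> kron_pow (P l) n $ x \<le> exp (- real n * v l)"
  shows "(\<Sum>x\<in>A. kron_pow (P k) n $ x) \<le> (Phi \<alpha> C P * exp ((\<Sum>l\<in>UNIV. \<alpha> l * v l) + \<kappa> - v k)) ^ n"
proof -
  let ?S = "param_supp \<alpha>"
  note S = A_plus_supp[OF \<alpha>(1)]
  define e where "e = (\<Sum>l\<in>UNIV. \<alpha> l * v l)"
  have C: "C \<noteq> {}" using k by auto
  define u where "u = vec N (\<lambda>i. if i \<in> common_supp P C then \<Prod>k\<in>?S. (P k $ i) powr \<alpha> k else 0)"
  have supp: "common_supp P C \<subseteq> {..<N}" by (rule common_supp_subset[OF P(1) C])
  have "vec_total u = (\<Sum>i<N. if i \<in> common_supp P C then \<Prod>k\<in>?S. (P k $ i) powr \<alpha> k else 0)"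
    by (simp add: vec_total_def u_def)
  also have "\<dots> = Phi \<alpha> C P"
    unfolding Phi_def using supp by (subst sum.inter_restrict[symmetric]) (auto simp: Int_absorb1)
  finally have total: "vec_total u = Phi \<alpha> C P" .
  have u0: "0 \<le> kron_pow u n $ x" if "x < N ^ n" for x
    using that by (intro kron_pow_nonneg) (auto simp: u_def intro!: prod_nonneg)
  have S_sum: "(\<Sum>l\<in>?S. \<alpha> l * (v l + \<kappa>)) = e + \<kappa>"
  proof -
    have "(\<Sum>l\<in>?S. \<alpha> l * v l) = e" unfolding e_def
      by (rule sum.mono_neutral_left) (auto simp: param_supp_def)
    moreover have "(\<Sum>l\<in>?S. \<alpha> l * \<kappa>) = \<kappa>" using S(2) by (simp flip: sum_distrib_right)
    ultimately show ?thesis by (simp add: distrib_left sum.distrib)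
  qed
  have "kron_pow (P k) n $ x \<le> kron_pow u n $ x * exp (e + \<kappa> - v k) ^ n" if x: "x \<in> A" for x
  proof -
    have xN: "x < N ^ n" using x A by auto
    obtain d where d: "\<forall>t<n. d t < N" "\<And>p. dim_vec p = N \<Longrightarrow> kron_pow p n $ x = (\<Prod>t<n. p $ d t)"
      using kron_pow_digits[OF xN] by blast
    \<comment> \<open>The positive lower bound in \<open>cell\<close> forces every digit into the
      common support over all of \<open>C\<close>, which may be smaller than that over the support
      of \<alpha>; this is why \<open>Phi \<alpha> C\<close> appears.\<close>
    have "P l $ d t \<noteq> 0" if l: "l \<in> C" and t: "t < n" for l t
    proof
      assume "P l $ d t = 0"
      then have "kron_pow (P l) n $ x = 0"
        using d(2)[of "P l"] P(1) t by (auto simp: of_length_dim prod_zero_iff)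
      then show False using cell(1)[OF l x] by (simp add: not_le)
    qed
    then have mem: "d t \<in> common_supp P C" if "t < n" for t
      using that d(1) P(1) by (auto simp: common_supp_def vec_supp_def of_length_dim)
    have "kron_pow u n $ x = (\<Prod>t<n. \<Prod>k\<in>?S. (P k $ d t) powr \<alpha> k)"
      using d mem by (simp add: u_def)
    also have "\<dots> = (\<Prod>k\<in>?S. \<Prod>t<n. (P k $ d t) powr \<alpha> k)" by (rule prod.swap)
    also have "\<dots> = (\<Prod>k\<in>?S. kron_pow (P k) n $ x powr \<alpha> k)"
      using d(2) P(1) by (simp add: prod_powr_distrib of_length_dim)
    also have "\<dots> \<ge> (\<Prod>k\<in>?S. exp (- real n * (v k + \<kappa>)) powr \<alpha> k)"
      using cell(1)[OF _ x] \<alpha>(2) S(1)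
      by (intro prod_mono conjI powr_mono2) (auto simp: less_imp_le)
    also have "(\<Prod>k\<in>?S. exp (- real n * (v k + \<kappa>)) powr \<alpha> k) = exp (\<Sum>k\<in>?S. - real n * (\<alpha> k * (v k + \<kappa>)))"
      by (simp add: exp_sum powr_def mult_ac)
    also have "(\<Sum>k\<in>?S. - real n * (\<alpha> k * (v k + \<kappa>))) = - real n * (e + \<kappa>)"
      unfolding sum_distrib_left[symmetric] S_sum ..
    finally have u: "exp (- real n * (e + \<kappa>)) \<le> kron_pow u n $ x" .
    have "kron_pow (P k) n $ x \<le> exp (- real n * v k)" by (rule cell(2)[OF k x])
    also have "\<dots> = exp (- real n * (e + \<kappa>)) * exp (real n * (e + \<kappa> - v k))"
      by (simp add: algebra_simps flip: exp_add)
    also have "\<dots> \<le> kron_pow u n $ x * exp (real n * (e + \<kappa> - v k))"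
      by (rule mult_right_mono[OF u]) simp
    finally show ?thesis by (simp add: exp_of_nat_mult)
  qed
  then have "(\<Sum>x\<in>A. kron_pow (P k) n $ x) \<le> (\<Sum>x\<in>A. kron_pow u n $ x * exp (e + \<kappa> - v k) ^ n)"
    by (rule sum_mono)
  also have "\<dots> \<le> (\<Sum>x<N ^ n. kron_pow u n $ x * exp (e + \<kappa> - v k) ^ n)"
    using A u0 by (intro sum_mono2) auto
  also have "\<dots> = vec_total u ^ n * exp (e + \<kappa> - v k) ^ n"
    by (simp add: u_def flip: vec_total_kron_pow sum_distrib_right) (simp add: vec_total_def)
  finally show ?thesis by (simp add: total e_def power_mult_distrib)
qed

subsection \<open>Asymptotic majorization\<close>

lemma prob_tuple_pow:
  assumes "prob_tuple P"
  shows "prob_tuple (tuple_pow P n)"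
proof -
  obtain N where N: "of_length N P" using prob_tuple_length[OF assms] by blast
  have "vec_total (P k) = 1" for k
    using prob_tuple_sum[OF assms N] N by (simp add: vec_total_def of_length_dim)
  then have "vec_total (tuple_pow P n k) = 1" for k
    by (simp add: tuple_pow_def vec_total_kron_pow)
  moreover have "dim_vec (tuple_pow P n k) = N ^ n" for k
    using of_length_pow[OF N, of n] by (simp add: of_length_dim)
  ultimately have "(\<Sum>i<N ^ n. tuple_pow P n k $ i) = 1" for k
    unfolding vec_total_def by metis
  moreover have "0 \<le> tuple_pow P n k $ i" if "i < N ^ n" for k i
    unfolding tuple_pow_def
    by (rule kron_pow_nonneg) (use that N prob_tuple_nonneg[OF assms N] in \<open>auto simp: of_length_dim\<close>)
  ultimately show ?thesis by (intro prob_tupleI[OF of_length_pow[OF N]])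
qed

text \<open>With \<open>c\<close> a lower bound for the positive entries of \<open>P\<close>, it
  bounds the exponents \<open>- ln (entry) / n\<close> uniformly in \<open>n\<close>, so that the
  number of groups does not grow.\<close>

lemma kron_pow_entry_ge:
  assumes x: "x < dim_vec p ^ n" "kron_pow p n $ x \<noteq> 0"
    and p: "\<And>i. i < dim_vec p \<Longrightarrow> p $ i \<noteq> 0 \<Longrightarrow> c \<le> p $ i" and c: "0 < (c :: real)"
  shows "c ^ n \<le> kron_pow p n $ x"
proof -
  obtain d where d: "\<forall>t<n. d t < dim_vec p" "kron_pow p n $ x = (\<Prod>t<n. p $ d t)"
    using kron_pow_digits[OF x(1)] by blast
  then have "\<forall>t<n. p $ d t \<noteq> 0" using x(2) by (auto simp: prod_zero_iff)
  then have "(\<Prod>t<n. c) \<le> (\<Prod>t<n. p $ d t)"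
    using p c d(1) by (intro prod_mono) auto
  then show ?thesis using d(2) by simp
qed

lemma kron_pow_entry_le_1:
  assumes x: "x < dim_vec p ^ n" and p: "\<And>i. i < dim_vec p \<Longrightarrow> 0 \<le> p $ i \<and> p $ i \<le> 1"
  shows "kron_pow p n $ x \<le> 1"
proof -
  obtain d where d: "\<forall>t<n. d t < dim_vec p" "kron_pow p n $ x = (\<Prod>t<n. p $ d t)"
    using kron_pow_digits[OF x] by blast
  then show ?thesis using p by (auto intro!: prod_le_1)
qed

lemma exists_entry_bound:
  fixes P :: "'d::finite vtuple"
  shows "\<exists>c>0. c \<le> 1 \<and> (\<forall>k i. i < N \<longrightarrow> 0 < P k $ i \<longrightarrow> c \<le> P k $ i)"
proof -
  \<comment> \<open>The inserted 1 keeps \<open>X\<close> nonempty and makes the bound at most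
    1.\<close>
  define X where "X = insert 1 ((\<lambda>(k, i). P k $ i) ` {(k, i). i < N \<and> 0 < P k $ i})"
  have "{(k, i). i < N \<and> 0 < P k $ i} \<subseteq> UNIV \<times> {..<N}" by auto
  then have fin: "finite X" unfolding X_def
    by (intro finite.insertI finite_imageI) (rule finite_subset, auto)
  have "0 < Min X" using fin by (subst Min_gr_iff) (auto simp: X_def)
  moreover have "Min X \<le> P k $ i" if "i < N" "0 < P k $ i" for k i
    using that fin by (intro Min_le) (auto simp: X_def)
  moreover have "Min X \<le> 1" using fin by (intro Min_le) (auto simp: X_def)
  ultimately show ?thesis by blast
qed

text \<open>Each group of mixed rows goes as a whole to its tilted law. The bounds for the mass of
  the group and for the law multiply to an exponentially small multiple of each column of
  \<open>tuple_pow Q n\<close>, so the boundedly many groups fit together and the remaining rows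
  fill up.\<close>

lemma asymptotic_majorization:
  fixes P Q :: "'d::finite vtuple"
  assumes P: "prob_tuple P" and Q: "prob_tuple Q" "of_length m Q" "\<And>k i. i < m \<Longrightarrow> 0 < Q k $ i"
    and \<rho>: "0 < \<rho>" "\<rho> < 1"
    and gap: "\<And>C \<alpha>. 2 \<le> card C \<Longrightarrow> \<alpha> \<in> A_plus \<Longrightarrow> param_supp \<alpha> \<subseteq> C \<Longrightarrow>
      Phi \<alpha> C P \<le> \<rho> * Phi \<alpha> (param_supp \<alpha>) Q"
  shows "\<forall>\<^sub>F n in sequentially. majorizes (tuple_pow P n) (tuple_pow Q n)"
proof -
  obtain N where N: "of_length N P" using prob_tuple_length[OF P] by blast
  note P0 = prob_tuple_nonneg[OF P N]
  have P1: "P k $ i \<le> 1" if "i < N" for k i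
    using member_le_sum[of i "{..<N}" "\<lambda>i. P k $ i"] P0 prob_tuple_sum[OF P N] that by simp
  have m: "0 < m"
    using prob_tuple_sum[OF Q(1,2)] by (metis lessThan_0 neq0_conv sum.empty zero_neq_one)
  obtain c where c: "0 < c" "c \<le> 1" "\<And>k i. i < N \<Longrightarrow> 0 < P k $ i \<Longrightarrow> c \<le> P k $ i"
    using exists_entry_bound[of N P] by blast
  \<comment> \<open>So \<open>\<rho> = exp (- 4 * \<kappa>)\<close>: the mesh of the exponents and
    the tilted law each cost a factor \<open>exp \<kappa>\<close> per power, and
    \<open>exp (- 2 * \<kappa>)\<close> remains.\<close>
  define \<kappa> where "\<kappa> = - ln \<rho> / 4"
  have \<kappa>: "0 < \<kappa>" using \<rho> by (simp add: \<kappa>_def)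
  \<comment> \<open>By the lower bound \<open>c\<close>, exponents in units of \<kappa> never exceed
    \<open>- ln c / \<kappa>\<close>, whatever \<open>n\<close> is.\<close>
  define Z where "Z = nat \<lfloor>- ln c / \<kappa>\<rfloor>"
  define groups where "groups = {C :: 'd set. 2 \<le> card C} \<times> {z :: 'd \<Rightarrow> nat. \<forall>k. z k \<le> Z}"
  have "{z :: 'd \<Rightarrow> nat. \<forall>k. z k \<le> Z} = Pi\<^sub>E UNIV (\<lambda>_. {..Z})" by auto
  then have "finite {z :: 'd \<Rightarrow> nat. \<forall>k. z k \<le> Z}" by (simp add: finite_PiE)
  then have fin: "finite groups" by (simp add: groups_def)
  define v where "v z k = \<kappa> * real (z k)" for z :: "'d \<Rightarrow> nat" and k
  \<comment> \<open>The parameter of a group is chosen before \<open>n\<close>; the finitely many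
    groups then share one threshold for \<open>n\<close>.\<close>
  have "\<forall>g. \<exists>\<alpha>. g \<in> groups \<longrightarrow> \<alpha> \<in> A_plus \<and> param_supp \<alpha> \<subseteq> fst g \<and> (\<forall>\<^sub>F n in sequentially. \<exists>w.
    (\<forall>y. 0 \<le> w y) \<and> (\<Sum>y<m ^ n. w y) = 1 \<and>
    (\<forall>k\<in>fst g. \<forall>y<m ^ n. w y \<le> 2 * kron_pow (Q k) n $ y *
        (exp (v (snd g) k - (\<Sum>l\<in>UNIV. \<alpha> l * v (snd g) l) + \<kappa>) / Phi \<alpha> (param_supp \<alpha>) Q) ^ n))"
  proof
    fix g :: "'d set \<times> ('d \<Rightarrow> nat)"
    show "\<exists>\<alpha>. g \<in> groups \<longrightarrow> \<alpha> \<in> A_plus \<and> param_supp \<alpha> \<subseteq> fst g \<and> (\<forall>\<^sub>F n in sequentially. \<exists>w.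
      (\<forall>y. 0 \<le> w y) \<and> (\<Sum>y<m ^ n. w y) = 1 \<and>
      (\<forall>k\<in>fst g. \<forall>y<m ^ n. w y \<le> 2 * kron_pow (Q k) n $ y *
        (exp (v (snd g) k - (\<Sum>l\<in>UNIV. \<alpha> l * v (snd g) l) + \<kappa>) / Phi \<alpha> (param_supp \<alpha>) Q) ^ n))"
    proof (cases "g \<in> groups")
      case True
      then have "fst g \<noteq> {}" by (auto simp: groups_def)
      from tilted_law[OF Q(2,3) m this \<kappa>, of "v (snd g)"] show ?thesis by blast
    qed simp
  qed
  from choice[OF this] obtain \<alpha> where \<alpha>: "\<And>g. g \<in> groups \<Longrightarrow> \<alpha> g \<in> A_plus"
      "\<And>g. g \<in> groups \<Longrightarrow> param_supp (\<alpha> g) \<subseteq> fst g"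
    and ev: "\<And>g. g \<in> groups \<Longrightarrow> \<forall>\<^sub>F n in sequentially. \<exists>w.
      (\<forall>y. 0 \<le> w y) \<and> (\<Sum>y<m ^ n. w y) = 1 \<and>
      (\<forall>k\<in>fst g. \<forall>y<m ^ n. w y \<le> 2 * kron_pow (Q k) n $ y *
        (exp (v (snd g) k - (\<Sum>l\<in>UNIV. \<alpha> g l * v (snd g) l) + \<kappa>) / Phi (\<alpha> g) (param_supp (\<alpha> g)) Q) ^ n)"
    by blast
  have "\<forall>\<^sub>F n in sequentially. \<forall>g\<in>groups. \<exists>w.
      (\<forall>y. 0 \<le> w y) \<and> (\<Sum>y<m ^ n. w y) = 1 \<and>
      (\<forall>k\<in>fst g. \<forall>y<m ^ n. w y \<le> 2 * kron_pow (Q k) n $ y *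
        (exp (v (snd g) k - (\<Sum>l\<in>UNIV. \<alpha> g l * v (snd g) l) + \<kappa>) / Phi (\<alpha> g) (param_supp (\<alpha> g)) Q) ^ n)"
    using ev by (intro eventually_ball_finite fin) blast
  moreover have "(\<lambda>n. real (card groups) * (2 * exp (- 2 * \<kappa>) ^ n)) \<longlonglongrightarrow> real (card groups) * (2 * 0)"
    using \<kappa> by (intro tendsto_mult tendsto_const LIMSEQ_realpow_zero) auto
  then have "\<forall>\<^sub>F n in sequentially. real (card groups) * (2 * exp (- 2 * \<kappa>) ^ n) < 1"
    by (rule order_tendstoD(2)) simp
  ultimately show ?thesis using eventually_gt_at_top[of 0]
  proof eventually_elim
    case (elim n)
    obtain w where "\<forall>g\<in>groups. (\<forall>y. 0 \<le> w g y) \<and> (\<Sum>y<m ^ n. w g y) = 1 \<and>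
      (\<forall>k\<in>fst g. \<forall>y<m ^ n. w g y \<le> 2 * kron_pow (Q k) n $ y *
        (exp (v (snd g) k - (\<Sum>l\<in>UNIV. \<alpha> g l * v (snd g) l) + \<kappa>) / Phi (\<alpha> g) (param_supp (\<alpha> g)) Q) ^ n)"
      using bchoice[OF elim(1)] by blast
    then have w: "\<And>g y. g \<in> groups \<Longrightarrow> 0 \<le> w g y" "\<And>g. g \<in> groups \<Longrightarrow> (\<Sum>y<m ^ n. w g y) = 1"
      "\<And>g k y. g \<in> groups \<Longrightarrow> k \<in> fst g \<Longrightarrow> y < m ^ n \<Longrightarrow> w g y \<le> 2 * kron_pow (Q k) n $ y *
        (exp (v (snd g) k - (\<Sum>l\<in>UNIV. \<alpha> g l * v (snd g) l) + \<kappa>) / Phi (\<alpha> g) (param_supp (\<alpha> g)) Q) ^ n"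
      by simp_all
    have n: "0 < n" using elim by simp
    define p where "p k x = kron_pow (P k) n $ x" for k x
    define q where "q k y = kron_pow (Q k) n $ y" for k y
    have q0: "0 \<le> q k y" if "y < m ^ n" for k y
      unfolding q_def using that Q by (intro kron_pow_nonneg) (auto simp: of_length_dim less_imp_le)
    have p0: "0 \<le> p k x" if "x < N ^ n" for k x
      unfolding p_def using that N P0 by (intro kron_pow_nonneg) (auto simp: of_length_dim)
    have p1: "p k x \<le> 1" if "x < N ^ n" for k x
      unfolding p_def using that N P0 P1 by (intro kron_pow_entry_le_1) (auto simp: of_length_dim)
    have pc: "c ^ n \<le> p k x" if "x < N ^ n" "p k x \<noteq> 0" for k x
      unfolding p_def
    proof (rule kron_pow_entry_ge[OF _ _ _ c(1)])
      show "x < dim_vec (P k) ^ n" "kron_pow (P k) n $ x \<noteq> 0"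
        using that N by (auto simp: of_length_dim p_def)
      show "c \<le> P k $ i" if "i < dim_vec (P k)" "P k $ i \<noteq> 0" for i
        using c(3)[of i k] P0[of i k] that N by (simp add: of_length_dim)
    qed
    \<comment> \<open>The exponent in units of the mesh \<kappa>. A zero entry gets 0 because
      \<open>ln 0 = 0\<close>, so \<open>z x\<close> is bounded in all columns, while only those in
      \<open>S x\<close> enter the bounds.\<close>
    define t where "t x k = - ln (p k x) / (real n * \<kappa>)" for x k
    define z where "z x k = nat \<lfloor>t x k\<rfloor>" for x k
    define S where "S x = {k. p k x \<noteq> 0}" for x
    define B where "B = {x. x < N ^ n \<and> 2 \<le> card (S x)}"
    define G where "G x = (S x, z x)" for x
    have t0: "0 \<le> t x k" if "x < N ^ n" for x k
    proof (cases "p k x = 0")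
      case False
      then have "ln (p k x) \<le> 0" using p0[OF that, of k] p1[OF that, of k] by simp
      then show ?thesis using n \<kappa> by (simp add: t_def divide_nonneg_pos divide_nonpos_pos)
    qed (simp add: t_def)
    have tZ: "t x k \<le> - ln c / \<kappa>" if "x < N ^ n" for x k
    proof (cases "p k x = 0")
      case True
      then show ?thesis using c \<kappa> by (simp add: t_def divide_nonpos_pos)
    next
      case False
      have "ln (c ^ n) \<le> ln (p k x)"
        using pc[OF that False] c(1) by (intro ln_mono) auto
      then have "real n * ln c \<le> ln (p k x)" using c(1) by (simp add: ln_realpow)
      then show ?thesis using n \<kappa> by (simp add: t_def field_simps)
    qed
    have GB: "G x \<in> groups" if "x \<in> B" for x
      using that tZ by (auto simp: B_def G_def groups_def z_def Z_def intro!: nat_mono floor_mono)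
    have cell: "exp (- real n * (v (z x) k + \<kappa>)) \<le> p k x" "p k x \<le> exp (- real n * v (z x) k)"
      if x: "x < N ^ n" and k: "k \<in> S x" for x k
    proof -
      have pk: "0 < p k x" using p0[OF x, of k] k by (simp add: S_def less_le)
      have eq: "ln (p k x) = - real n * (\<kappa> * t x k)" using n \<kappa> by (simp add: t_def)
      have z: "real (z x k) \<le> t x k" "t x k \<le> real (z x k) + 1"
        using t0[OF x, of k] by (simp_all add: z_def)
      have "v (z x) k \<le> \<kappa> * t x k" "\<kappa> * t x k \<le> v (z x) k + \<kappa>"
        using mult_left_mono[OF z(1), of \<kappa>] mult_left_mono[OF z(2), of \<kappa>] \<kappa>
        by (simp_all add: v_def distrib_left)
      then have "- real n * (v (z x) k + \<kappa>) \<le> ln (p k x)" "ln (p k x) \<le> - real n * v (z x) k"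
        unfolding eq by (simp_all add: mult_left_mono)
      then show "exp (- real n * (v (z x) k + \<kappa>)) \<le> p k x" "p k x \<le> exp (- real n * v (z x) k)"
        using pk by (metis exp_le_cancel_iff exp_ln)+
    qed
    have group_bound: "(\<Sum>x\<in>{x \<in> B. G x = g}. w g y * p k x) \<le> q k y * (2 * exp (- 2 * \<kappa>) ^ n)"
      if g: "g \<in> groups" and y: "y < m ^ n" for g y k
    proof (cases "k \<in> fst g")
      case False
      then have "p k x = 0" if "G x = g" for x using that by (auto simp: G_def S_def)
      then have "(\<Sum>x\<in>{x \<in> B. G x = g}. w g y * p k x) = 0" by (intro sum.neutral) auto
      then show ?thesis using q0[OF y, of k] by simp
    next
      case True
      let ?A = "{x \<in> B. G x = g}"
      define e where "e = (\<Sum>l\<in>UNIV. \<alpha> g l * v (snd g) l)"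
      define \<Phi>P where "\<Phi>P = Phi (\<alpha> g) (fst g) P"
      define \<Phi>Q where "\<Phi>Q = Phi (\<alpha> g) (param_supp (\<alpha> g)) Q"
      have \<Phi>Q: "0 < \<Phi>Q"
      proof -
        have "0 \<in> common_supp Q UNIV"
          using m Q(3)[OF m] by (simp add: common_supp_iff[OF Q(2)] less_imp_neq[symmetric])
        then have "common_supp Q UNIV \<noteq> {}" by blast
        then show ?thesis unfolding \<Phi>Q_def by (intro Phi_pos Q(1) \<alpha>(1) g)
      qed
      have \<Phi>P: "0 \<le> \<Phi>P" unfolding \<Phi>P_def Phi_def by (intro sum_nonneg prod_nonneg) simp
      have le: "\<Phi>P \<le> \<rho> * \<Phi>Q" unfolding \<Phi>P_def \<Phi>Q_def
        using g \<alpha>[OF g] by (intro gap) (auto simp: groups_def)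
      have mass: "(\<Sum>x\<in>?A. p k x) \<le> (\<Phi>P * exp (e + \<kappa> - v (snd g) k)) ^ n"
        unfolding p_def \<Phi>P_def e_def
      proof (rule type_cell_mass[OF N P0 \<alpha>(1)[OF g] \<alpha>(2)[OF g] True])
        show "?A \<subseteq> {..<N ^ n}" by (auto simp: B_def)
        fix l x assume "l \<in> fst g" "x \<in> ?A"
        then have "x < N ^ n" "l \<in> S x" "snd g = z x" by (auto simp: G_def B_def)
        then show "exp (- real n * (v (snd g) l + \<kappa>)) \<le> kron_pow (P l) n $ x"
          "kron_pow (P l) n $ x \<le> exp (- real n * v (snd g) l)"
          using cell[of x l] by (auto simp: p_def)
      qed simp
      have "(\<Sum>x\<in>?A. w g y * p k x) = w g y * (\<Sum>x\<in>?A. p k x)" by (simp add: sum_distrib_left)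
      also have "\<dots> \<le> (2 * q k y * (exp (v (snd g) k - e + \<kappa>) / \<Phi>Q) ^ n) * (\<Phi>P * exp (e + \<kappa> - v (snd g) k)) ^ n"
      proof (rule mult_mono[OF _ mass])
        show "w g y \<le> 2 * q k y * (exp (v (snd g) k - e + \<kappa>) / \<Phi>Q) ^ n"
          using w(3)[OF g True y] by (simp add: e_def \<Phi>Q_def q_def)
        show "0 \<le> 2 * q k y * (exp (v (snd g) k - e + \<kappa>) / \<Phi>Q) ^ n"
          using q0[OF y, of k] \<Phi>Q by simp
        show "0 \<le> (\<Sum>x\<in>?A. p k x)" using p0 by (intro sum_nonneg) (auto simp: B_def)
      qed
      \<comment> \<open>The terms \<open>v (snd g) k - e\<close> cancel, so the factor that
        multiplies \<open>q k y\<close> is the same for every column \<open>k\<close>.\<close>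
      also have "\<dots> = 2 * q k y * (\<Phi>P / \<Phi>Q * (exp (v (snd g) k - e + \<kappa>) * exp (e + \<kappa> - v (snd g) k))) ^ n"
        by (simp add: power_mult_distrib power_divide)
      also have "exp (v (snd g) k - e + \<kappa>) * exp (e + \<kappa> - v (snd g) k) = exp (2 * \<kappa>)"
        by (simp flip: exp_add)
      also have "2 * q k y * (\<Phi>P / \<Phi>Q * exp (2 * \<kappa>)) ^ n \<le> 2 * q k y * (exp (- 2 * \<kappa>)) ^ n"
      proof (intro mult_left_mono power_mono)
        have "\<Phi>P / \<Phi>Q \<le> \<rho>" using le \<Phi>Q by (simp add: divide_simps)
        also have "\<rho> = exp (- 4 * \<kappa>)" using \<rho>(1) by (simp add: \<kappa>_def)
        finally have "\<Phi>P / \<Phi>Q * exp (2 * \<kappa>) \<le> exp (- 4 * \<kappa>) * exp (2 * \<kappa>)" by (rule mult_right_mono) simp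
        also have "\<dots> = exp (- 2 * \<kappa>)" by (simp flip: exp_add)
        finally show "\<Phi>P / \<Phi>Q * exp (2 * \<kappa>) \<le> exp (- 2 * \<kappa>)" .
        show "0 \<le> \<Phi>P / \<Phi>Q * exp (2 * \<kappa>)" using \<Phi>P \<Phi>Q by simp
        show "0 \<le> 2 * q k y" using q0[OF y, of k] by simp
      qed
      finally show ?thesis by (simp add: mult_ac)
    qed
    show ?case
    proof (rule majorizes_by_filling[OF prob_tuple_pow[OF P] of_length_pow[OF N]
          prob_tuple_pow[OF Q(1)] of_length_pow[OF Q(2)], where B = B and W = "\<lambda>y x. w (G x) y"])
      show "B \<subseteq> {..<N ^ n}" by (auto simp: B_def)
      show "0 \<le> w (G j) i" if "j \<in> B" for i j using w(1)[OF GB[OF that]] .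
      show "(\<Sum>i<m ^ n. w (G j) i) = 1" if "j \<in> B" for j using w(2)[OF GB[OF that]] .
      show "(\<Sum>x\<in>B. w (G x) y * tuple_pow P n k $ x) \<le> tuple_pow Q n k $ y" if y: "y < m ^ n" for k y
      proof -
        have finB: "finite B" by (simp add: B_def)
        have "(\<Sum>x\<in>B. w (G x) y * tuple_pow P n k $ x) = (\<Sum>x\<in>B. w (G x) y * p k x)"
          by (simp add: tuple_pow_def p_def)
        also have "\<dots> = (\<Sum>g\<in>groups. \<Sum>x\<in>{x \<in> B. G x = g}. w (G x) y * p k x)"
          using finB fin GB by (intro sum.group[symmetric]) auto
        also have "\<dots> = (\<Sum>g\<in>groups. \<Sum>x\<in>{x \<in> B. G x = g}. w g y * p k x)"
          by (intro sum.cong refl) auto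
        also have "\<dots> \<le> (\<Sum>g\<in>groups. q k y * (2 * exp (- 2 * \<kappa>) ^ n))"
          by (intro sum_mono group_bound y)
        also have "\<dots> = q k y * (real (card groups) * (2 * exp (- 2 * \<kappa>) ^ n))" by simp
        also have "\<dots> \<le> q k y" using elim q0[OF y, of k] by (simp add: mult_left_le)
        finally show ?thesis by (simp add: tuple_pow_def q_def)
      qed
      show "\<exists>k. \<forall>l. l \<noteq> k \<longrightarrow> tuple_pow P n l $ j = 0" if "j < N ^ n" "j \<notin> B" for j
      proof -
        have "card (S j) \<le> 1" using that by (auto simp: B_def)
        then obtain k where "S j \<subseteq> {k}"
          by (metis card_le_Suc0_iff_eq empty_subsetI finite One_nat_def insertI1 subsetI subset_singletonD singletonD subset_singleton_iff)
        then show ?thesis by (intro exI[of _ k]) (auto simp: S_def p_def tuple_pow_def)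
      qed
    qed
  qed
qed

subsection \<open>Power universality\<close>

lemma prob_tuple_Vd:
  assumes "prob_tuple P" "common_supp P UNIV \<noteq> {}"
  shows "P \<in> Vd"
proof -
  obtain n where n: "of_length n P" using prob_tuple_length[OF assms(1)] by blast
  have "n \<ge> 1" using assms(2) common_supp_iff[OF n] by fastforce
  then show ?thesis using assms n prob_tuple_nonneg[OF assms(1) n]
    unfolding Vd_iff by blast
qed

lemma S_rel_refl: "P \<in> Vd \<Longrightarrow> S_rel P P"
  by (simp add: S_rel_iff)

lemma tuple_pow_Vd: "P \<in> Vd \<Longrightarrow> tuple_pow P n \<in> Vd"
  by (induction n) (simp_all add: tuple_pow_0 tuple_pow_Suc one_tuple_Vd Vd_kron)

lemma abs_S_kron: "P \<in> Vd \<Longrightarrow> Q \<in> Vd \<Longrightarrow> abs_S (tuple_kron P Q) = abs_S P * abs_S Q"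
  by (simp add: times_S.abs_eq S_rel_refl)

lemma abs_S_sum: "P \<in> Vd \<Longrightarrow> Q \<in> Vd \<Longrightarrow> abs_S (tuple_sum P Q) = abs_S P + abs_S Q"
  by (simp add: plus_S.abs_eq S_rel_refl)

lemma abs_S_pow: "P \<in> Vd \<Longrightarrow> abs_S (tuple_pow P n) = abs_S P ^ n"
  by (induction n) (simp_all add: tuple_pow_0 tuple_pow_Suc abs_S_kron tuple_pow_Vd one_S_def)

lemma abs_S_le_iff: "P \<in> Vd \<Longrightarrow> Q \<in> Vd \<Longrightarrow> abs_S Q \<le> abs_S P \<longleftrightarrow> majorizes P Q"
  by (simp add: less_eq_S.abs_eq S_rel_refl)

lemma kron_pow_supp_mono:
  assumes pq: "dim_vec p = dim_vec q" "\<And>i. i < dim_vec p \<Longrightarrow> p $ i \<noteq> 0 \<Longrightarrow> q $ i \<noteq> 0"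
    and j: "j < dim_vec p ^ n" "kron_pow p n $ j \<noteq> 0"
  shows "kron_pow q n $ j \<noteq> 0"
proof -
  obtain d where d: "\<forall>t<n. d t < dim_vec p"
    "\<And>r. dim_vec r = dim_vec p \<Longrightarrow> kron_pow r n $ j = (\<Prod>t<n. r $ d t)"
    using kron_pow_digits[OF j(1)] by blast
  have "\<forall>t<n. p $ d t \<noteq> 0" using j(2) d(2)[of p] by (auto simp: prod_zero_iff)
  then have "\<forall>t<n. q $ d t \<noteq> 0" using pq(2) d(1) by blast
  then show ?thesis using d(2)[of q] pq(1) by (auto simp: prod_zero_iff)
qed

text \<open>Powers of \<open>P\<close> must be able to produce a tuple that has a row vanishing in column \<open>l\<close> but
  not in column \<open>k\<close>.\<close>

lemma power_universal_separates:
  fixes P :: "'d::finite vtuple"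
  assumes pu: "power_universal (abs_S P)" and P: "P \<in> Vd" "of_length N P" and kl: "k \<noteq> l"
    and P0: "\<And>k i. i < N \<Longrightarrow> 0 \<le> P k $ i"
  shows "\<exists>i<N. P k $ i \<noteq> 0 \<and> P l $ i = 0"
proof (rule ccontr)
  assume "\<not> ?thesis"
  then have supp: "P l $ i \<noteq> 0" if "i < N" "P k $ i \<noteq> 0" for i using that by auto
  \<comment> \<open>Row 1 of \<open>Y\<close> vanishes in column \<open>l\<close> only; row 0 is
    positive throughout and puts \<open>Y\<close> into \<open>Vd\<close>. All columns sum to 1, so
    adding up the rows gives \<open>1 <= abs_S Y\<close>.\<close>
  define Y :: "'d vtuple" where "Y = (\<lambda>j. vec 2 (\<lambda>i. if j = l then (if i = 0 then 1 else 0) else 1 / 2))"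
  have Y2: "of_length 2 Y" by (simp add: of_length_iff Y_def)
  have "0 \<in> common_supp Y UNIV" by (simp add: common_supp_iff[OF Y2]) (simp add: Y_def)
  then have "common_supp Y UNIV \<noteq> {}" by blast
  then have Y: "Y \<in> Vd" unfolding Vd_iff using Y2
    by (intro exI[of _ 2]) (auto simp: Y_def)
  have one: "of_length 1 one_tuple" by (simp add: of_length_iff one_tuple_def)
  have "majorizes Y one_tuple"
    by (rule majorizes_kernelI[OF Y2 one, where W = "\<lambda>_ _. 1"])
      (auto simp: Y_def one_tuple_def numeral_2_eq_2)
  then have "1 \<le> abs_S Y" by (simp add: one_S_def abs_S_le_iff Y one_tuple_Vd)
  then obtain n where "abs_S Y \<le> abs_S P ^ n"
    using pu unfolding power_universal_def by (metis mult_1)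
  then have "majorizes (tuple_pow P n) Y"
    using P(1) Y by (simp add: abs_S_le_iff tuple_pow_Vd flip: abs_S_pow)
  from majorizes_kernelD[OF this of_length_pow[OF P(2)]]
  obtain m W where m: "of_length m Y" and W: "\<forall>i<m. \<forall>j<N ^ n. 0 \<le> W i j"
    "\<forall>k. \<forall>i<m. Y k $ i = (\<Sum>j<N ^ n. W i j * tuple_pow P n k $ j)" by blast
  have "m = 2" using m Y2 of_length_dim by metis
  then have W1: "0 \<le> W 1 j" if "j < N ^ n" for j using W(1) that by simp
  have Yk: "Y h $ 1 = (\<Sum>j<N ^ n. W 1 j * kron_pow (P h) n $ j)" for h
    using W(2) \<open>m = 2\<close> by (simp add: tuple_pow_def)
  have d: "dim_vec (P h) = N" for h using P(2) by (simp add: of_length_dim)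
  have nn: "0 \<le> kron_pow (P h) n $ j" if "j < N ^ n" for h j
    using that P0 by (intro kron_pow_nonneg) (auto simp: d)
  \<comment> \<open>A zero sum of nonnegative terms: row 1 of the map uses only rows where column
    \<open>l\<close> vanishes. By the assumed inclusion of supports column \<open>k\<close> vanishes
    there too, against \<open>Y k $ 1 = 1 / 2\<close>.\<close>
  have "(\<Sum>j<N ^ n. W 1 j * kron_pow (P l) n $ j) = 0" using Yk[of l] by (simp add: Y_def)
  then have z: "W 1 j * kron_pow (P l) n $ j = 0" if "j < N ^ n" for j
    using that W1 nn by (subst (asm) sum_nonneg_eq_0_iff) auto
  have "W 1 j * kron_pow (P k) n $ j = 0" if j: "j < N ^ n" for j
    using z[OF j] kron_pow_supp_mono[of "P k" "P l" j n] supp j by (auto simp: d)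
  then have "(\<Sum>j<N ^ n. W 1 j * kron_pow (P k) n $ j) = 0" by (intro sum.neutral) blast
  then show False using Yk[of k] kl by (simp add: Y_def)
qed

subsection \<open>Approximation by tuples of full support\<close>

lemma Phi_le_weighted_mass:
  assumes P: "of_length n P" "\<And>k i. i < n \<Longrightarrow> 0 \<le> P k $ i" and \<alpha>: "\<alpha> \<in> A_plus"
    and S: "param_supp \<alpha> \<subseteq> C"
  shows "Phi \<alpha> C P \<le> (\<Sum>k\<in>param_supp \<alpha>. \<alpha> k * (\<Sum>i\<in>common_supp P C. P k $ i))"
proof -
  have "C \<noteq> {}" using S A_plus_supp(3)[OF \<alpha>] by auto
  then have cs: "common_supp P C \<subseteq> {..<n}" by (rule common_supp_subset[OF P(1)])
  have "Phi \<alpha> C P \<le> (\<Sum>i\<in>common_supp P C. \<Sum>k\<in>param_supp \<alpha>. \<alpha> k * P k $ i)"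
    unfolding Phi_def using cs P(2) A_plus_supp[OF \<alpha>] by (intro sum_mono weighted_am_gm) auto
  also have "\<dots> = (\<Sum>k\<in>param_supp \<alpha>. \<alpha> k * (\<Sum>i\<in>common_supp P C. P k $ i))"
    by (subst sum.swap) (simp add: sum_distrib_left)
  finally show ?thesis .
qed

text \<open>By AM-GM \<open>Phi\<close> is at most an \<alpha>-average of the column masses on the
  common support over \<open>C\<close>, so a bound for all columns in \<open>C\<close> passes to
  it.\<close>

lemma Phi_le_convex_bound:
  assumes P: "of_length n P" "\<And>k i. i < n \<Longrightarrow> 0 \<le> P k $ i" and \<alpha>: "\<alpha> \<in> A_plus"
    and S: "param_supp \<alpha> \<subseteq> C" and le: "\<And>k. k \<in> C \<Longrightarrow> (\<Sum>i\<in>common_supp P C. P k $ i) \<le> b"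
  shows "Phi \<alpha> C P \<le> b"
proof -
  have "Phi \<alpha> C P \<le> (\<Sum>k\<in>param_supp \<alpha>. \<alpha> k * (\<Sum>i\<in>common_supp P C. P k $ i))"
    by (rule Phi_le_weighted_mass[OF P \<alpha> S])
  also have "\<dots> \<le> (\<Sum>k\<in>param_supp \<alpha>. \<alpha> k * b)"
    using A_plus_supp(1)[OF \<alpha>] S le by (intro sum_mono mult_left_mono) (auto simp: less_imp_le)
  also have "\<dots> = b" using A_plus_supp(2)[OF \<alpha>] by (simp flip: sum_distrib_right)
  finally show ?thesis .
qed

text \<open>\<open>R\<close> mixes \<open>Q\<close> with weight \<eta> of the uniform distribution;
  by superadditivity this raises \<open>Phi\<close> to at least
  \<open>(1 - \<eta>) * Phi + \<eta>\<close>, while separation of the supports keeps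
  \<open>Phi \<alpha> C P\<close> at most \<open>1 - c\<close>. Together these turn the weak
  inequalities into a gap that is uniform in \<alpha> and \<open>C\<close>.\<close>

lemma full_support_approximation:
  fixes P Q :: "'d::finite vtuple"
  assumes P: "prob_tuple P" and Q: "prob_tuple Q" "of_length m Q"
    and N: "of_length N P" and sep: "\<And>k l. k \<noteq> l \<Longrightarrow> \<exists>i<N. P k $ i \<noteq> 0 \<and> P l $ i = 0"
    and le: "\<And>\<alpha>. \<alpha> \<in> A_plus - range unit_param \<Longrightarrow> Phi \<alpha> (param_supp \<alpha>) P \<le> Phi \<alpha> (param_supp \<alpha>) Q"
    and \<epsilon>: "0 < \<epsilon>"
  shows "\<exists>R \<rho>. prob_tuple R \<and> of_length m R \<and> (\<forall>k. \<forall>i<m. 0 < R k $ i) \<and>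
    (\<forall>k. l1_dist (Q k) (R k) \<le> \<epsilon>) \<and> 0 < \<rho> \<and> \<rho> < 1 \<and>
    (\<forall>C. \<forall>\<alpha>\<in>A_plus. 2 \<le> card C \<longrightarrow> param_supp \<alpha> \<subseteq> C \<longrightarrow> Phi \<alpha> C P \<le> \<rho> * Phi \<alpha> (param_supp \<alpha>) R)"
proof -
  \<comment> \<open>The mixing moves each column by at most \<open>2 * \<eta>\<close>; the bound
    \<open>1 / 2\<close> keeps \<rho> positive.\<close>
  define \<eta> where "\<eta> = min (1 / 2) (\<epsilon> / 2)"
  have \<eta>: "0 < \<eta>" "\<eta> \<le> 1 / 2" "\<eta> \<le> \<epsilon> / 2" using \<epsilon> by (auto simp: \<eta>_def)
  note P0 = prob_tuple_nonneg[OF P N] and Q0 = prob_tuple_nonneg[OF Q]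
  have m: "0 < m"
    using prob_tuple_sum[OF Q] by (metis lessThan_0 neq0_conv sum.empty zero_neq_one)
  define R :: "'d vtuple" where "R = (\<lambda>k. vec m (\<lambda>i. (1 - \<eta>) * Q k $ i + \<eta> / real m))"
  have Rm: "of_length m R" by (simp add: of_length_iff R_def)
  have Rpos: "0 < R k $ i" if "i < m" for k i
    using that \<eta> m Q0[OF that, of k] by (simp add: R_def add_nonneg_pos)
  have Rsum: "(\<Sum>i<m. R k $ i) = 1" for k
    using prob_tuple_sum[OF Q, of k] m by (simp add: R_def sum.distrib flip: sum_distrib_left)
  have Rp: "prob_tuple R" by (rule prob_tupleI[OF Rm]) (use Rpos Rsum in \<open>auto simp: less_imp_le\<close>)
  have dist: "l1_dist (Q k) (R k) \<le> \<epsilon>" for k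
  proof -
    have "l1_dist (Q k) (R k) = (\<Sum>i<m. \<bar>Q k $ i - R k $ i\<bar>)"
      using Q(2) Rm by (simp add: l1_dist_def entry0_def of_length_dim)
    also have "\<dots> \<le> (\<Sum>i<m. \<eta> * Q k $ i + \<eta> / real m)"
    proof (rule sum_mono)
      fix i assume "i \<in> {..<m}"
      then have i: "i < m" by simp
      have "Q k $ i - R k $ i = \<eta> * Q k $ i - \<eta> / real m"
        using i by (simp add: R_def algebra_simps)
      moreover have "0 \<le> \<eta> * Q k $ i" "0 \<le> \<eta> / real m" using \<eta> Q0[OF i] by auto
      ultimately show "\<bar>Q k $ i - R k $ i\<bar> \<le> \<eta> * Q k $ i + \<eta> / real m" by linarith
    qed
    also have "\<dots> = 2 * \<eta>"
      using prob_tuple_sum[OF Q, of k] m by (simp add: sum.distrib flip: sum_distrib_left)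
    finally show ?thesis using \<eta> by linarith
  qed
  obtain c where c: "0 < c" "c \<le> 1" "\<And>k i. i < N \<Longrightarrow> 0 < P k $ i \<Longrightarrow> c \<le> P k $ i"
    using exists_entry_bound[of N P] by blast
  define \<rho> where "\<rho> = 1 - \<eta> * c"
  have \<eta>c: "0 < \<eta> * c" "\<eta> * c \<le> 1 / 2" using \<eta> c mult_mono[of \<eta> "1 / 2" c 1] by auto
  have "Phi \<alpha> C P \<le> \<rho> * Phi \<alpha> (param_supp \<alpha>) R"
    if \<alpha>: "\<alpha> \<in> A_plus" and C: "2 \<le> card C" and S: "param_supp \<alpha> \<subseteq> C" for \<alpha> C
  proof -
    define x where "x = Phi \<alpha> C P"
    define y where "y = Phi \<alpha> (param_supp \<alpha>) R"
    have "x \<le> 1 - c" unfolding x_def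
    proof (rule Phi_le_convex_bound[OF N P0 \<alpha> S])
      fix k assume k: "k \<in> C"
      have cs: "common_supp P C \<subseteq> {..<N}" using k by (intro common_supp_subset[OF N]) auto
      \<comment> \<open>Column \<open>k\<close> is separated by some row from another column of
        \<open>C\<close>, and this row keeps mass at least \<open>c\<close> of column
        \<open>k\<close> outside the common support.\<close>
      have "\<not> C \<subseteq> {k}" using C card_mono[of "{k}" C] by auto
      then obtain l where l: "l \<in> C" "l \<noteq> k" by blast
      obtain i where i: "i < N" "P k $ i \<noteq> 0" "P l $ i = 0" using sep[of k l] l(2) by metis
      have ic: "i \<notin> common_supp P C" using l(1) i(3) by (auto simp: common_supp_def vec_supp_def)
      have "(\<Sum>j\<in>common_supp P C. P k $ j) + P k $ i = (\<Sum>j\<in>insert i (common_supp P C). P k $ j)"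
        using ic finite_subset[OF cs] by (simp add: add.commute)
      also have "\<dots> \<le> (\<Sum>j<N. P k $ j)" using cs i P0 by (intro sum_mono2) auto
      also have "\<dots> = 1" by (rule prob_tuple_sum[OF P N])
      finally show "(\<Sum>j\<in>common_supp P C. P k $ j) \<le> 1 - c"
        using c(3)[of i k] i P0[OF i(1), of k] by simp
    qed simp
    have y1: "y \<le> 1" unfolding y_def
    proof (rule Phi_le_convex_bound[OF Rm _ \<alpha> order_refl])
      fix k assume "k \<in> param_supp \<alpha>"
      then have "common_supp R (param_supp \<alpha>) \<subseteq> {..<m}" by (intro common_supp_subset[OF Rm]) auto
      then have "(\<Sum>i\<in>common_supp R (param_supp \<alpha>). R k $ i) \<le> (\<Sum>i<m. R k $ i)"
        using Rpos by (intro sum_mono2) (auto simp: less_imp_le)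
      then show "(\<Sum>i\<in>common_supp R (param_supp \<alpha>). R k $ i) \<le> 1" by (simp add: Rsum)
    qed (use Rpos in \<open>auto simp: less_imp_le\<close>)
    have "(1 - \<eta>) * x + \<eta> \<le> y"
    proof (cases "\<alpha> \<in> range unit_param")
      \<comment> \<open>At a vertex the hypothesis \<open>le\<close> says nothing, but there
        \<open>y\<close> is a column sum of \<open>R\<close>, hence 1.\<close>
      case True
      then obtain k where k: "\<alpha> = unit_param k" by auto
      have "unit_param k k = 1" by (simp add: unit_param_def)
      moreover have "y = (\<Sum>i<m. \<Prod>l\<in>param_supp (unit_param k). (R l $ i) powr unit_param k l)"
        by (simp only: y_def k Phi_eq_sum[OF Rm unit_param_A_plus])
      ultimately have "y = (\<Sum>i<m. R k $ i)" using Rpos by (simp add: less_imp_le)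
      then have "y = 1" by (simp add: Rsum)
      moreover have "(1 - \<eta>) * x \<le> (1 - \<eta>) * 1"
        using \<open>x \<le> 1 - c\<close> c \<eta> by (intro mult_left_mono) auto
      ultimately show ?thesis by simp
    next
      case False
      note S\<alpha> = A_plus_supp[OF \<alpha>]
      have "x \<le> Phi \<alpha> (param_supp \<alpha>) P" unfolding x_def Phi_def
      proof (rule sum_mono2)
        show "finite (common_supp P (param_supp \<alpha>))"
          using finite_subset[OF common_supp_subset[OF N S\<alpha>(3)]] by blast
        show "common_supp P C \<subseteq> common_supp P (param_supp \<alpha>)"
          using S by (auto simp: common_supp_def)
      qed (simp add: prod_nonneg)
      also have "\<dots> \<le> Phi \<alpha> (param_supp \<alpha>) Q" using le \<alpha> False by blast
      finally have "(1 - \<eta>) * x + \<eta> \<le> (1 - \<eta>) * Phi \<alpha> (param_supp \<alpha>) Q + \<eta>"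
        using \<eta> by (simp add: mult_left_mono)
      also have "\<dots> = (\<Sum>i<m. (1 - \<eta>) * (\<Prod>k\<in>param_supp \<alpha>. (Q k $ i) powr \<alpha> k) + \<eta> / real m)"
        using m by (simp add: Phi_eq_sum[OF Q(2) \<alpha>] sum.distrib sum_distrib_left)
      also have "\<dots> \<le> (\<Sum>i<m. \<Prod>k\<in>param_supp \<alpha>. (R k $ i) powr \<alpha> k)"
      proof (rule sum_mono)
        fix i assume "i \<in> {..<m}"
        then have i: "i < m" by simp
        \<comment> \<open>Superadditivity for two terms, indexed by \<open>bool\<close>: the row of
          \<open>Q\<close> with weight \<open>1 - \<eta>\<close> and the constant row 1 with weight
          \<open>\<eta> / m\<close>.\<close>
        have "(\<Sum>j\<in>(UNIV :: bool set). (if j then 1 - \<eta> else \<eta> / real m) *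
              (\<Prod>k\<in>param_supp \<alpha>. (if j then Q k $ i else 1) powr \<alpha> k)) \<le>
            (\<Prod>k\<in>param_supp \<alpha>. (\<Sum>j\<in>(UNIV :: bool set). (if j then 1 - \<eta> else \<eta> / real m) * (if j then Q k $ i else 1)) powr \<alpha> k)"
          using S\<alpha> \<eta> m Q0[OF i] by (intro weighted_geometric_mean_superadditive) auto
        then show "(1 - \<eta>) * (\<Prod>k\<in>param_supp \<alpha>. (Q k $ i) powr \<alpha> k) + \<eta> / real m \<le>
            (\<Prod>k\<in>param_supp \<alpha>. (R k $ i) powr \<alpha> k)"
          using i by (simp add: UNIV_bool R_def add.commute)
      qed
      also have "\<dots> = y" by (simp add: y_def Phi_eq_sum[OF Rm \<alpha>])
      finally show ?thesis .
    qed
    \<comment> \<open>Now \<open>y >= x + \<eta> * (1 - x) >= x + \<eta> * c\<close>, and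
      \<open>y <= 1\<close> turns this additive gap into the factor \<rho>.\<close>
    moreover have "\<eta> * c \<le> \<eta> * (1 - x)" using \<open>x \<le> 1 - c\<close> \<eta> by (intro mult_left_mono) auto
    moreover have "\<eta> * c * y \<le> \<eta> * c" using y1 \<eta>c by (simp add: mult_left_le)
    ultimately have "x \<le> \<rho> * y" by (simp add: \<rho>_def algebra_simps)
    then show ?thesis by (simp add: x_def y_def)
  qed
  moreover have "0 < \<rho>" "\<rho> < 1" using \<eta>c by (auto simp: \<rho>_def)
  ultimately show ?thesis using Rp Rm Rpos dist by blast
qed

subsection \<open>The catalyst\<close>

lemma vec_total_concat: "vec_total (vec_concat vs) = (\<Sum>v\<leftarrow>vs. vec_total v)"
proof (induction vs)
  case Nil
  then show ?case by (simp add: vec_concat_def vec_total_def)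
next
  case (Cons v vs)
  have "vec_total (v @\<^sub>v u) = vec_total v + vec_total u" for u
    by (simp add: vec_total_def sum_lessThan_add)
  then show ?case using Cons by (simp add: vec_concat_def)
qed

text \<open>Concatenation becomes addition in the semiring. The empty list is excluded: its
  concatenation has length 0 and so is no element of \<open>Vd\<close>.\<close>

lemma tuple_concat_S:
  assumes "Xs \<noteq> []" "\<And>X. X \<in> set Xs \<Longrightarrow> X \<in> Vd"
  shows "(\<lambda>k. vec_concat (map (\<lambda>X. X k) Xs)) \<in> Vd \<and>
    abs_S (\<lambda>k. vec_concat (map (\<lambda>X. X k) Xs)) = (\<Sum>X\<leftarrow>Xs. abs_S X)"
  using assms
proof (induction Xs rule: list_nonempty_induct)
  case (single X)
  have "(\<lambda>k. vec_concat (map (\<lambda>X. X k) [X])) = X"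
    by (rule ext) (auto simp: vec_concat_def intro!: eq_vecI)
  then show ?case using single by simp
next
  case (cons X Xs)
  have "(\<lambda>k. vec_concat (map (\<lambda>X. X k) (X # Xs))) = tuple_sum X (\<lambda>k. vec_concat (map (\<lambda>X. X k) Xs))"
    by (simp add: vec_concat_def tuple_sum_def)
  then show ?case using cons by (simp add: Vd_sum abs_S_sum)
qed

text \<open>The block diagonal sum \<open>V\<close> of the given map and an identity does
  it.\<close>

lemma majorizes_sum_right:
  assumes "majorizes P Q" "of_length n P" "of_length l R"
  shows "majorizes (tuple_sum P R) (tuple_sum Q R)"
proof -
  obtain m W where m: "of_length m Q" and W0: "\<forall>i<m. \<forall>j<n. 0 \<le> W i j"
    and W1: "\<forall>j<n. (\<Sum>i<m. W i j) = 1" and eq: "\<forall>k. \<forall>i<m. Q k $ i = (\<Sum>j<n. W i j * P k $ j)"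
    using majorizes_kernelD[OF assms(1,2)] by blast
  define V where "V i j = (if i < m then if j < n then W i j else 0 else if i - m + n = j then 1 else (0 :: real))" for i j
  show ?thesis
  proof (rule majorizes_kernelI[OF of_length_sum[OF assms(2,3)] of_length_sum[OF m assms(3)], where W = V])
    show "0 \<le> V i j" if "i < m + l" "j < n + l" for i j using W0 that by (simp add: V_def)
    show "(\<Sum>i<m + l. V i j) = 1" if j: "j < n + l" for j
    proof (cases "j < n")
      case True
      then show ?thesis using W1 by (simp add: sum_lessThan_add V_def)
    next
      case False
      have "(\<Sum>i<l. V (m + i) j) = (\<Sum>i<l. if i = j - n then 1 else 0)"
        using False by (intro sum.cong) (auto simp: V_def)
      then show ?thesis using False j by (simp add: sum_lessThan_add) (simp add: V_def)
    qed
    show "(\<Sum>j<n + l. V i j * tuple_sum P R k $ j) = tuple_sum Q R k $ i" if i: "i < m + l" for k i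
    proof (cases "i < m")
      case True
      then show ?thesis using eq assms m by (simp add: sum_lessThan_add V_def tuple_sum_def of_length_dim)
    next
      case False
      have "(\<Sum>j<l. V i (n + j) * R k $ j) = (\<Sum>j<l. if j = i - m then R k $ j else 0)"
        using False by (intro sum.cong) (auto simp: V_def)
      also have "\<dots> = R k $ (i - m)" using False i by simp
      finally have "(\<Sum>j<l. V i (n + j) * R k $ j) = R k $ (i - m)" .
      moreover have "(\<Sum>j<n. V i j * P k $ j) = 0"
        using False by (intro sum.neutral) (auto simp: V_def)
      ultimately show ?thesis using False i assms m
        by (simp add: sum_lessThan_add tuple_sum_def of_length_dim)
    qed
  qed
qed

lemma S_add_right_mono:
  fixes a b c :: "'d::finite S"
  assumes "a \<le> b"
  shows "a + c \<le> b + c"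
  using assms
proof (transfer)
  fix a b c :: "'d vtuple"
  assume "S_rel a a" "S_rel b b" "S_rel c c" "majorizes b a"
  then show "majorizes (tuple_sum b c) (tuple_sum a c)"
    by (auto simp: S_rel_iff dest!: Vd_length intro: majorizes_sum_right)
qed

text \<open>It restores the factor \<open>1 / (n + 1)\<close> of the catalyst after a computation in
  the semiring with the unnormalized sum.\<close>

lemma majorizes_smult:
  assumes "majorizes P Q" "of_length n P"
  shows "majorizes (\<lambda>k. c \<cdot>\<^sub>v P k) (\<lambda>k. c \<cdot>\<^sub>v Q k)"
proof -
  obtain m W where m: "of_length m Q" and W: "\<forall>i<m. \<forall>j<n. 0 \<le> W i j" "\<forall>j<n. (\<Sum>i<m. W i j) = 1"
    and eq: "\<forall>k. \<forall>i<m. Q k $ i = (\<Sum>j<n. W i j * P k $ j)"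
    using majorizes_kernelD[OF assms] by blast
  show ?thesis
  proof (rule majorizes_kernelI[where W = W and n = n and m = m])
    show "(\<Sum>j<n. W i j * (c \<cdot>\<^sub>v P k) $ j) = (c \<cdot>\<^sub>v Q k) $ i" if "i < m" for k i
      using that m assms(2) eq by (simp add: of_length_dim sum_distrib_left mult_ac)
  qed (use W m assms(2) in \<open>auto simp: of_length_iff\<close>)
qed

lemma smult_kron: "(c \<cdot>\<^sub>v p) \<otimes>\<^sub>v q = c \<cdot>\<^sub>v (p \<otimes>\<^sub>v q)"
  by (rule eq_vecI) (auto simp: kron_index div_less_mult)

text \<open>Multiplying the catalyst by \<open>P\<close> or by \<open>R\<close> gives sums that share all terms but \<open>P ^ (n + 1)\<close>
  and \<open>R ^ (n + 1)\<close>.\<close>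

lemma catalyst_majorizes:
  fixes P R :: "'d::finite vtuple"
  assumes P: "prob_tuple P" "common_supp P UNIV \<noteq> {}" and R: "prob_tuple R" "common_supp R UNIV \<noteq> {}"
    and maj: "majorizes (tuple_pow P (Suc n)) (tuple_pow R (Suc n))"
  shows "prob_tuple (catalyst P R n)" "common_supp (catalyst P R n) UNIV \<noteq> {}"
    "majorizes (tuple_kron (catalyst P R n) P) (tuple_kron (catalyst P R n) R)"
proof -
  note PV = prob_tuple_Vd[OF P] and RV = prob_tuple_Vd[OF R]
  define f where "f l = tuple_kron (tuple_pow R l) (tuple_pow P (n - l))" for l
  define U where "U = (\<lambda>k. vec_concat (map (\<lambda>X. X k) (map f [0..<n + 1])))"
  define c where "c = 1 / real (n + 1)"
  have cat: "catalyst P R n = (\<lambda>k. c \<cdot>\<^sub>v U k)"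
    by (simp add: catalyst_def U_def f_def c_def tuple_kron_def tuple_pow_def o_def)
  have fV: "f l \<in> Vd" for l by (simp add: f_def Vd_kron tuple_pow_Vd PV RV)
  define x where "x = abs_S P"
  define y where "y = abs_S R"
  have fS: "abs_S (f l) = y ^ l * x ^ (n - l)" for l
    by (simp add: f_def abs_S_kron abs_S_pow tuple_pow_Vd PV RV x_def y_def)
  have UV: "U \<in> Vd" and "abs_S U = (\<Sum>X\<leftarrow>map f [0..<n + 1]. abs_S X)"
    unfolding U_def using tuple_concat_S[of "map f [0..<n + 1]"] fV by auto
  then have "abs_S U = (\<Sum>l\<leftarrow>[0..<n + 1]. y ^ l * x ^ (n - l))"
    by (simp add: fS o_def del: upt_Suc)
  then have US: "abs_S U = (\<Sum>l<Suc n. y ^ l * x ^ (n - l))"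
    by (simp only: interv_sum_list_conv_sum_set_nat set_upt lessThan_atLeast0 Suc_eq_plus1)
  obtain u where u: "1 \<le> u" "of_length u U" and U0: "\<forall>k. \<forall>i<u. 0 \<le> U k $ i"
    and Uc: "common_supp U UNIV \<noteq> {} \<or> (\<forall>k. U k = 0\<^sub>v u)"
    using UV by (auto simp: Vd_iff)
  have c: "0 < c" by (simp add: c_def)
  have total: "vec_total (U k) = real (n + 1)" for k
  proof -
    have t: "vec_total (P k) = 1" "vec_total (R k) = 1"
      using P(1) R(1) by (simp_all add: prob_tuple_def prob_vec_def vec_total_def)
    have "vec_total (f l k) = 1" for l
      by (simp add: f_def tuple_kron_def tuple_pow_def vec_total_kron vec_total_kron_pow t)
    then show ?thesis by (simp add: U_def vec_total_concat o_def sum_list_triv)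
  qed
  have cl: "of_length u (catalyst P R n)" using u(2) by (simp add: cat of_length_iff)
  show "prob_tuple (catalyst P R n)"
  proof (rule prob_tupleI[OF cl])
    show "0 \<le> catalyst P R n k $ i" if "i < u" for k i
      using that u(2) U0 c by (simp add: cat of_length_dim)
    show "(\<Sum>i<u. catalyst P R n k $ i) = 1" for k
    proof -
      have "(\<Sum>i<u. catalyst P R n k $ i) = c * (\<Sum>i<u. U k $ i)"
        using u(2) by (simp add: cat of_length_dim sum_distrib_left)
      also have "(\<Sum>i<u. U k $ i) = vec_total (U k)" using u(2) by (simp add: vec_total_def of_length_dim)
      finally show ?thesis using total[of k] by (simp add: c_def)
    qed
  qed
  \<comment> \<open>An element of \<open>Vd\<close> without common support is zero, which the column
    totals exclude.\<close>
  have "\<not> (\<forall>k. U k = 0\<^sub>v u)"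
  proof
    assume "\<forall>k. U k = 0\<^sub>v u"
    then have "vec_total (U undefined) = 0" by (simp add: vec_total_def)
    then show False using total[of undefined] by simp
  qed
  then obtain i where "i \<in> common_supp U UNIV" using Uc by auto
  then have "i \<in> common_supp (catalyst P R n) UNIV"
    using c u(2) unfolding common_supp_iff[OF cl] common_supp_iff[OF u(2)]
    by (auto simp: cat of_length_dim)
  then show "common_supp (catalyst P R n) UNIV \<noteq> {}" by blast
  \<comment> \<open>Multiplication by \<open>y\<close> turns term \<open>l\<close> of
    \<open>U\<close> into \<open>g (Suc l)\<close>, multiplication by \<open>x\<close> turns it into
    \<open>g l\<close>, so the two sums differ only in their end terms.\<close>
  define g where "g l = y ^ l * x ^ (Suc n - l)" for l
  have "y ^ Suc n \<le> x ^ Suc n"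
    using maj by (simp add: x_def y_def abs_S_le_iff tuple_pow_Vd PV RV flip: abs_S_pow del: power_Suc)
  have "abs_S U * y = (\<Sum>l<Suc n. g (Suc l))"
    unfolding US sum_distrib_right by (intro sum.cong) (auto simp: g_def mult_ac)
  also have "\<dots> = y ^ Suc n + (\<Sum>l<n. g (Suc l))" by (simp add: g_def add.commute)
  also have "\<dots> \<le> x ^ Suc n + (\<Sum>l<n. g (Suc l))"
    by (rule S_add_right_mono) fact
  also have "\<dots> = (\<Sum>l<Suc n. g l)" by (simp only: sum.lessThan_Suc_shift) (simp add: g_def)
  also have "\<dots> = abs_S U * x"
    unfolding US sum_distrib_right
    by (intro sum.cong) (auto simp: g_def mult_ac Suc_diff_le less_Suc_eq_le)
  finally have "majorizes (tuple_kron U P) (tuple_kron U R)"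
    by (simp add: x_def y_def abs_S_le_iff Vd_kron UV PV RV flip: abs_S_kron)
  moreover obtain N where N: "of_length N P" using prob_tuple_length[OF P(1)] by blast
  ultimately have "majorizes (\<lambda>k. c \<cdot>\<^sub>v tuple_kron U P k) (\<lambda>k. c \<cdot>\<^sub>v tuple_kron U R k)"
    using majorizes_smult[OF _ of_length_kron[OF u(2) N]] by blast
  then show "majorizes (tuple_kron (catalyst P R n) P) (tuple_kron (catalyst P R n) R)"
    by (simp add: cat tuple_kron_def smult_kron)
qed

section \<open>Equivalence of the inequalities with catalytic and asymptotic majorization\<close>

theorem theorem14:
  fixes P Q :: "'d::finite vtuple"
  assumes "CARD('d) \<ge> 2"
    and "prob_tuple P" and "common_supp P UNIV \<noteq> {}"
    and "prob_tuple Q" and "common_supp Q UNIV \<noteq> {}"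
    and "power_universal (abs_S P)"
  shows
    "((\<forall>\<alpha> \<in> A_plus - range unit_param. Phi \<alpha> (param_supp \<alpha>) P \<le> Phi \<alpha> (param_supp \<alpha>) Q)
      \<longleftrightarrow>
      (\<forall>\<epsilon>>0. \<exists>Q\<^sub>\<epsilon> R\<^sub>\<epsilon> T.
        prob_tuple Q\<^sub>\<epsilon> \<and> common_supp Q\<^sub>\<epsilon> UNIV \<noteq> {} \<and>
        prob_tuple R\<^sub>\<epsilon> \<and> common_supp R\<^sub>\<epsilon> UNIV \<noteq> {} \<and>
        stochastic T \<and>
        (\<forall>k. l1_dist (Q k) (Q\<^sub>\<epsilon> k) \<le> \<epsilon>) \<and>
        maps_to T (tuple_kron R\<^sub>\<epsilon> P) (tuple_kron R\<^sub>\<epsilon> Q\<^sub>\<epsilon>)))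
     \<and>
     ((\<forall>\<alpha> \<in> A_plus - range unit_param. Phi \<alpha> (param_supp \<alpha>) P \<le> Phi \<alpha> (param_supp \<alpha>) Q)
      \<longleftrightarrow>
      (\<forall>\<epsilon>>0. \<exists>Q\<^sub>\<epsilon>.
        prob_tuple Q\<^sub>\<epsilon> \<and> common_supp Q\<^sub>\<epsilon> UNIV \<noteq> {} \<and>
        (\<forall>k. l1_dist (Q k) (Q\<^sub>\<epsilon> k) \<le> \<epsilon>) \<and>
        (\<forall>\<^sub>F n in sequentially. \<exists>T. stochastic T \<and> maps_to T (tuple_pow P n) (tuple_pow Q\<^sub>\<epsilon> n))))
     \<and>
     ((\<forall>\<alpha> \<in> A_plus - range unit_param. Phi \<alpha> (param_supp \<alpha>) P \<le> Phi \<alpha> (param_supp \<alpha>) Q)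
      \<longrightarrow>
      (\<forall>\<epsilon>>0. \<exists>Q\<^sub>\<epsilon>.
        prob_tuple Q\<^sub>\<epsilon> \<and> common_supp Q\<^sub>\<epsilon> UNIV \<noteq> {} \<and>
        (\<forall>k. l1_dist (Q k) (Q\<^sub>\<epsilon> k) \<le> \<epsilon>) \<and>
        (\<forall>\<^sub>F n in sequentially.
          prob_tuple (catalyst P Q\<^sub>\<epsilon> n) \<and> common_supp (catalyst P Q\<^sub>\<epsilon> n) UNIV \<noteq> {} \<and>
          (\<exists>T. stochastic T \<and>
            maps_to T (tuple_kron (catalyst P Q\<^sub>\<epsilon> n) P) (tuple_kron (catalyst P Q\<^sub>\<epsilon> n) Q\<^sub>\<epsilon>)))))"
    (is "(?i \<longleftrightarrow> ?ii) \<and> (?i \<longleftrightarrow> ?iii) \<and> (?i \<longrightarrow> ?cat)")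
proof -
  obtain N m where N: "of_length N P" and m: "of_length m Q"
    using prob_tuple_length assms(2,4) by blast
  note P0 = prob_tuple_nonneg[OF assms(2) N]
  have sep: "\<exists>i<N. P k $ i \<noteq> 0 \<and> P l $ i = 0" if "k \<noteq> l" for k l
    by (rule power_universal_separates[OF assms(6) prob_tuple_Vd[OF assms(2,3)] N that P0])
  \<comment> \<open>One tuple \<open>R\<close> serves for \<open>?iii\<close> as well as for the
    catalyst, and thus for \<open>?ii\<close>.\<close>
  have approx: "\<exists>R. prob_tuple R \<and> common_supp R UNIV \<noteq> {} \<and> (\<forall>k. l1_dist (Q k) (R k) \<le> \<epsilon>) \<and>
      (\<forall>\<^sub>F n in sequentially. majorizes (tuple_pow P n) (tuple_pow R n))"
    if i: ?i and \<epsilon>: "0 < \<epsilon>" for \<epsilon>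
  proof -
    obtain R \<rho> where R: "prob_tuple R" "of_length m R" "\<forall>k. \<forall>i<m. 0 < R k $ i"
      "\<forall>k. l1_dist (Q k) (R k) \<le> \<epsilon>" and \<rho>: "0 < \<rho>" "\<rho> < 1"
      and gap: "\<forall>C. \<forall>\<alpha>\<in>A_plus. 2 \<le> card C \<longrightarrow> param_supp \<alpha> \<subseteq> C \<longrightarrow> Phi \<alpha> C P \<le> \<rho> * Phi \<alpha> (param_supp \<alpha>) R"
      using full_support_approximation[OF assms(2,4) m N sep _ \<epsilon>] i by blast
    have "\<forall>\<^sub>F n in sequentially. majorizes (tuple_pow P n) (tuple_pow R n)"
      using R(3) gap by (intro asymptotic_majorization[OF assms(2) R(1,2) _ \<rho>]) auto
    moreover obtain i where "i \<in> common_supp Q UNIV" using assms(5) by blast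
    then have "i \<in> common_supp R UNIV"
      using R(3) by (auto simp: common_supp_iff[OF m] common_supp_iff[OF R(2)] less_imp_neq[symmetric])
    ultimately show ?thesis using R(1,4) by blast
  qed
  have cat: ?cat if i: ?i
  proof (intro allI impI)
    fix \<epsilon> :: real assume "0 < \<epsilon>"
    from approx[OF i this] obtain R where R: "prob_tuple R" "common_supp R UNIV \<noteq> {}"
      "\<forall>k. l1_dist (Q k) (R k) \<le> \<epsilon>" and ev: "\<forall>\<^sub>F n in sequentially. majorizes (tuple_pow P n) (tuple_pow R n)"
      by blast
    \<comment> \<open>The catalyst with index \<open>n\<close> comes from majorization of the powers
      \<open>Suc n\<close>.\<close>
    have "\<forall>\<^sub>F n in sequentially. majorizes (tuple_pow P (Suc n)) (tuple_pow R (Suc n))"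
      by (rule eventually_sequentially_Suc[of "\<lambda>n. majorizes (tuple_pow P n) (tuple_pow R n)", THEN iffD2, OF ev])
    then have "\<forall>\<^sub>F n in sequentially. prob_tuple (catalyst P R n) \<and> common_supp (catalyst P R n) UNIV \<noteq> {} \<and>
      majorizes (tuple_kron (catalyst P R n) P) (tuple_kron (catalyst P R n) R)"
      by eventually_elim (use catalyst_majorizes[OF assms(2,3) R(1,2)] in blast)
    then show "\<exists>Q\<^sub>\<epsilon>. prob_tuple Q\<^sub>\<epsilon> \<and> common_supp Q\<^sub>\<epsilon> UNIV \<noteq> {} \<and>
        (\<forall>k. l1_dist (Q k) (Q\<^sub>\<epsilon> k) \<le> \<epsilon>) \<and>
        (\<forall>\<^sub>F n in sequentially.
          prob_tuple (catalyst P Q\<^sub>\<epsilon> n) \<and> common_supp (catalyst P Q\<^sub>\<epsilon> n) UNIV \<noteq> {} \<and>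
          (\<exists>T. stochastic T \<and>
            maps_to T (tuple_kron (catalyst P Q\<^sub>\<epsilon> n) P) (tuple_kron (catalyst P Q\<^sub>\<epsilon> n) Q\<^sub>\<epsilon>)))"
      using R unfolding majorizes_def by blast
  qed
  have "?ii" if i: ?i
  proof (intro allI impI)
    fix \<epsilon> :: real assume "0 < \<epsilon>"
    with cat[OF i] obtain R where R: "prob_tuple R" "common_supp R UNIV \<noteq> {}"
      "\<forall>k. l1_dist (Q k) (R k) \<le> \<epsilon>" and ev: "\<forall>\<^sub>F n in sequentially.
          prob_tuple (catalyst P R n) \<and> common_supp (catalyst P R n) UNIV \<noteq> {} \<and>
          (\<exists>T. stochastic T \<and> maps_to T (tuple_kron (catalyst P R n) P) (tuple_kron (catalyst P R n) R))"
      by blast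
    from eventually_happens'[OF sequentially_bot ev]
    show "\<exists>Q\<^sub>\<epsilon> R\<^sub>\<epsilon> T.
        prob_tuple Q\<^sub>\<epsilon> \<and> common_supp Q\<^sub>\<epsilon> UNIV \<noteq> {} \<and>
        prob_tuple R\<^sub>\<epsilon> \<and> common_supp R\<^sub>\<epsilon> UNIV \<noteq> {} \<and>
        stochastic T \<and>
        (\<forall>k. l1_dist (Q k) (Q\<^sub>\<epsilon> k) \<le> \<epsilon>) \<and>
        maps_to T (tuple_kron R\<^sub>\<epsilon> P) (tuple_kron R\<^sub>\<epsilon> Q\<^sub>\<epsilon>)"
      using R by blast
  qed
  moreover have "?iii" if i: ?i using approx[OF i] unfolding majorizes_def by blast
  \<comment> \<open>\<open>Phi\<close> is monotone and multiplicative, so the positive factor of the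
    catalyst cancels; then \<epsilon> tends to 0.\<close>
  moreover have "?i" if ii: ?ii
  proof
    fix \<alpha> :: "'d \<Rightarrow> real" assume "\<alpha> \<in> A_plus - range unit_param"
    then have \<alpha>: "\<alpha> \<in> A_plus" by blast
    show "Phi \<alpha> (param_supp \<alpha>) P \<le> Phi \<alpha> (param_supp \<alpha>) Q"
    proof (rule Phi_l1_limit[OF assms(4) \<alpha>])
      fix \<epsilon> :: real assume "0 < \<epsilon>"
      with ii obtain R C T where R: "prob_tuple R" "\<forall>k. l1_dist (Q k) (R k) \<le> \<epsilon>"
        and C: "prob_tuple C" "common_supp C UNIV \<noteq> {}"
        and T: "stochastic T" "maps_to T (tuple_kron C P) (tuple_kron C R)" by blast
      have maj: "majorizes (tuple_kron C P) (tuple_kron C R)" using T unfolding majorizes_def by blast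
      obtain c r where c: "of_length c C" and r: "of_length r R"
        using prob_tuple_length C(1) R(1) by blast
      have "0 \<le> tuple_kron C P k $ i" if "i < c * N" for k i
      proof -
        have "tuple_kron C P k $ i = C k $ (i div N) * P k $ (i mod N)"
          using that c N by (simp add: tuple_kron_def kron_index of_length_dim)
        then show ?thesis
          using prob_tuple_nonneg[OF C(1) c div_less_mult[OF that]] P0[OF mod_less_mult[OF that]] by simp
      qed
      from Phi_majorizes_mono[OF maj of_length_kron[OF c N] this \<alpha>]
      have "Phi \<alpha> (param_supp \<alpha>) C * Phi \<alpha> (param_supp \<alpha>) P \<le> Phi \<alpha> (param_supp \<alpha>) C * Phi \<alpha> (param_supp \<alpha>) R"
        by (simp add: Phi_kron[OF c N \<alpha>] Phi_kron[OF c r \<alpha>])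
      then have "Phi \<alpha> (param_supp \<alpha>) P \<le> Phi \<alpha> (param_supp \<alpha>) R"
        using Phi_pos[OF C \<alpha>] by simp
      then show "\<exists>R. prob_tuple R \<and> (\<forall>k. l1_dist (Q k) (R k) \<le> \<epsilon>) \<and>
        Phi \<alpha> (param_supp \<alpha>) P \<le> Phi \<alpha> (param_supp \<alpha>) R" using R by blast
    qed
  qed
  moreover have "?i" if iii: ?iii
  proof
    fix \<alpha> :: "'d \<Rightarrow> real" assume "\<alpha> \<in> A_plus - range unit_param"
    then have \<alpha>: "\<alpha> \<in> A_plus" by blast
    show "Phi \<alpha> (param_supp \<alpha>) P \<le> Phi \<alpha> (param_supp \<alpha>) Q"
    proof (rule Phi_l1_limit[OF assms(4) \<alpha>])
      fix \<epsilon> :: real assume "0 < \<epsilon>"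
      with iii obtain R where R: "prob_tuple R" "common_supp R UNIV \<noteq> {}" "\<forall>k. l1_dist (Q k) (R k) \<le> \<epsilon>"
        and ev: "\<forall>\<^sub>F n in sequentially. \<exists>T. stochastic T \<and> maps_to T (tuple_pow P n) (tuple_pow R n)"
        by blast
      from ev have "\<forall>\<^sub>F n in sequentially. majorizes (tuple_pow P n) (tuple_pow R n)"
        unfolding majorizes_def .
      \<comment> \<open>A single power with \<open>n > 0\<close> is enough, since taking
        \<open>n\<close>-th roots recovers the inequality for \<open>Phi\<close>.\<close>
      from eventually_happens'[OF sequentially_bot eventually_conj[OF this eventually_gt_at_top[of 0]]]
      obtain n where n: "majorizes (tuple_pow P n) (tuple_pow R n)" "0 < n" by blast
      obtain r where r: "of_length r R" using prob_tuple_length R(1) by blast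
      have "0 \<le> tuple_pow P n k $ i" if "i < N ^ n" for k i
        unfolding tuple_pow_def
        by (rule kron_pow_nonneg) (use that N P0 in \<open>auto simp: of_length_dim\<close>)
      from Phi_majorizes_mono[OF n(1) of_length_pow[OF N] this \<alpha>]
      have "Phi \<alpha> (param_supp \<alpha>) P ^ n \<le> Phi \<alpha> (param_supp \<alpha>) R ^ n"
        by (simp add: Phi_pow[OF N \<alpha>] Phi_pow[OF r \<alpha>])
      then have "Phi \<alpha> (param_supp \<alpha>) P \<le> Phi \<alpha> (param_supp \<alpha>) R"
        using n(2) Phi_pos[OF assms(2,3) \<alpha>] Phi_pos[OF R(1,2) \<alpha>] by (simp add: power_mono_iff)
      then show "\<exists>R. prob_tuple R \<and> (\<forall>k. l1_dist (Q k) (R k) \<le> \<epsilon>) \<and>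
        Phi \<alpha> (param_supp \<alpha>) P \<le> Phi \<alpha> (param_supp \<alpha>) R" using R by blast
    qed
  qed
  ultimately show ?thesis using cat by blast
qed

end
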